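(* Consider the Cauchy problem $$u_{tt}-\Delta u+b(t)u_t-g(t)\Delta u_t=0,\quad (t,x)\in[0,\infty)\times\mathbb{R}^n,\qquad u(0,x)=u_0(x),\quad u_t(0,x)=u_1(x),\quad x\in\mathbb{R}^n.$$ Assume that for all $t\in[0,\infty)$ the coefficient $g$ satisfies: (A1) $g(t)>0$ and $g'(t)>0$; (A2) $1/g\in L^1([0,\infty))$; (A3) $|d_t^k g(t)|\le C_k\, g(t)\big(\tfrac{g(t)}{G(t)}\big)^k$ for $k=1,2$, where $G(t):=\tfrac12\int_0^t g(\tau)\,d\tau$ and $C_1,C_2$ are positive constants; and that the strictly positive coefficient $b$ satisfies: (B1) $b\in\mathcal C^2([0,\infty))$; (B2) $b'(t)$ does not change its sign and $t\,b(t)\to\infty$ as $t\to\infty$; (B3) $\dfrac{|b^{(k)}(t)|}{b(t)}\lesssim\dfrac1{(1+t)^k}$ for $k=1,2$; (EF) $|b'(t)|\le a\,b^2(t)$ with a constant $a<1$. Then for $|\beta|\ge0$ Sobolev solutions satisfy $$\||D|^{|\beta|}u(t,\cdot)\|_{L^2}\lesssim\|u_0\|_{\dot H^{|\beta|}}+\|\langle D\rangle^{-2}u_1\|_{\dot H^{|\beta|}}.$$ If $b'\ge0$, then $$\||D|^{|\beta|}u_t(t,\cdot)\|_{L^2}\lesssim g(t)\big(\|u_0\|_{\dot H^{|\beta|+2}}+\|\langle D\rangle^{-2}u_1\|_{\dot H^{|\beta|+2}}\big)+b(t)\big(\|u_0\|_{\dot H^{|\beta|}}+\|\langle D\rangle^{-2}u_1\|_{\dot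 H^{|\beta|}}\big).$$ If $b'<0$, then $$\||D|^{|\beta|}u_t(t,\cdot)\|_{L^2}\lesssim g(t)\big(\|u_0\|_{\dot H^{|\beta|+2}}+\|u_1\|_{\dot H^{|\beta|}}\big)+b(t)\big(\|u_0\|_{\dot H^{|\beta|}}+\||D|^{-2}u_1\|_{\dot H^{|\beta|}}\big).$$
   Context: $f\lesssim h$ means $f\le Ch$ with a constant $C>0$ independent of $t$ and of the data. $|D|^a$ and $\langle D\rangle^a$ are the Fourier multipliers with symbols $|\xi|^a$ and $\langle\xi\rangle^a=(1+|\xi|^2)^{a/2}$; $\dot H^a=\dot H^a(\mathbb{R}^n)$ is the Riesz potential space based on $L^2$ with norm $\||\xi|^a\hat f\|_{L^2}$. $|\beta|$ denotes the order of differentiation (a number). Each estimate is understood for data for which its right-hand side is finite. Sobolev solutions are understood via the partial Fourier transform in $x$: $\hat u(t,\xi)$ solves $\hat u_{tt}+|\xi|^2\hat u+(b(t)+g(t)|\xi|^2)\hat u_t=0$, $\hat u(0,\xi)=\hat u_0(\xi)$, $\hat u_t(0,\xi)=\hat u_1(\xi)$. At $t=0$, where $G(0)=0$, the bounds involving $g/G$ are regarded as void. *)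

theory Defs
  imports "HOL-Analysis.Analysis"
begin

fun iter_deriv :: "'a::euclidean_space list \<Rightarrow> ('a \<Rightarrow> complex) \<Rightarrow> 'a \<Rightarrow> complex" where
  "iter_deriv [] \<phi> = \<phi>"
| "iter_deriv (v # vs) \<phi> = (\<lambda>x. frechet_derivative (iter_deriv vs \<phi>) (at x) v)"

definition schwartz :: "('a::euclidean_space \<Rightarrow> complex) set" where
  "schwartz = {\<phi>. \<forall>vs\<in>lists Basis.
      (\<forall>x. iter_deriv vs \<phi> differentiable at x) \<and>
      (\<forall>k::nat. bounded (range (\<lambda>x. (1 + norm x) ^ k *\<^sub>R iter_deriv vs \<phi> x)))}"

text \<open>Unitary normalisation, so that Plancherel's identity has constant 1 and
  the negative Laplacian has the symbol \<open>(norm \<xi>)\<^sup>2\<close>.\<close>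

definition fourier :: "('a::euclidean_space \<Rightarrow> complex) \<Rightarrow> 'a \<Rightarrow> complex" where
  "fourier \<phi> \<xi> =
     of_real ((2 * pi) powr (- real DIM('a) / 2)) * (LINT x|lborel. cis (- (x \<bullet> \<xi>)) * \<phi> x)"

definition inv_fourier :: "('a::euclidean_space \<Rightarrow> complex) \<Rightarrow> 'a \<Rightarrow> complex" where
  "inv_fourier \<phi> x =
     of_real ((2 * pi) powr (- real DIM('a) / 2)) * (LINT \<xi>|lborel. cis (x \<bullet> \<xi>) * \<phi> \<xi>)"

text \<open>A distribution is given by its values on test functions; only the values on
  \<^const>\<open>schwartz\<close> matter.\<close>

type_synonym 'a distribution = "('a \<Rightarrow> complex) \<Rightarrow> complex"

text \<open>The Fourier transform of \<open>T\<close> is the function \<open>h\<close>: by duality,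
  \<open>T (fourier \<phi>)\<close> is the pairing of \<open>h\<close> with \<open>\<phi>\<close>. A function that is integrable against every
  Schwartz function defines a tempered distribution (uniform boundedness principle), so continuity
  of \<open>T\<close> on the Schwartz space need not be required separately.\<close>

definition has_fourier_transform ::
    "'a::euclidean_space distribution \<Rightarrow> ('a \<Rightarrow> complex) \<Rightarrow> bool" where
  "has_fourier_transform T h \<longleftrightarrow> h \<in> borel_measurable lborel \<and>
     (\<forall>\<phi>\<in>schwartz. integrable lborel (\<lambda>\<xi>. h \<xi> * \<phi> \<xi>) \<and>
        T (fourier \<phi>) = (LINT \<xi>|lborel. h \<xi> * \<phi> \<xi>))"

text \<open>The function \<open>h\<close> above is unique up to null sets; a Borel representative is chosen. Everything
  below is insensitive to changes on null sets.\<close>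

definition hat :: "'a::euclidean_space distribution \<Rightarrow> 'a \<Rightarrow> complex" where
  "hat T = (SOME h. has_fourier_transform T h)"

definition inv_fourier_dist :: "('a::euclidean_space \<Rightarrow> complex) \<Rightarrow> 'a distribution" where
  "inv_fourier_dist h = (\<lambda>\<psi>. LINT \<xi>|lborel. h \<xi> * inv_fourier \<psi> \<xi>)"

definition symbol_mult :: "('a \<Rightarrow> real) \<Rightarrow> ('a \<Rightarrow> complex) \<Rightarrow> 'a \<Rightarrow> complex" where
  "symbol_mult m h = (\<lambda>\<xi>. of_real (m \<xi>) * h \<xi>)"

definition fourier_multiplier ::
    "('a::euclidean_space \<Rightarrow> real) \<Rightarrow> 'a distribution \<Rightarrow> 'a distribution" where
  "fourier_multiplier m T = inv_fourier_dist (symbol_mult m (hat T))"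

definition D_symbol :: "real \<Rightarrow> 'a::euclidean_space \<Rightarrow> real" where
  "D_symbol a \<xi> = norm \<xi> powr a"

definition J_symbol :: "real \<Rightarrow> 'a::euclidean_space \<Rightarrow> real" where
  "J_symbol a \<xi> = (1 + (norm \<xi>)\<^sup>2) powr (a / 2)"

definition L2_norm :: "('a::euclidean_space \<Rightarrow> complex) \<Rightarrow> ennreal" where
  "L2_norm f = (let I = \<integral>\<^sup>+ x. ennreal ((norm (f x))\<^sup>2) \<partial>lborel
     in if I = \<infinity> then \<infinity> else ennreal (sqrt (enn2real I)))"

text \<open>The norm in physical space of a distribution: infinite unless it is given by an
  \<open>L\<^sup>2\<close> function (which is then unique up to null sets).\<close>

definition L2_norm_dist :: "'a::euclidean_space distribution \<Rightarrow> ennreal" where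
  "L2_norm_dist T = (INF f \<in> {f \<in> borel_measurable lborel. L2_norm f < \<infinity> \<and>
     (\<forall>\<psi>\<in>schwartz. T \<psi> = (LINT x|lborel. f x * \<psi> x))}. L2_norm f)"

text \<open>The homogeneous Sobolev norm of \<open>f\<close>, as a function of the Fourier transform of \<open>f\<close>. Thus the
  norm of \<open>m(D) f\<close> is \<open>hdot_norm a (symbol_mult m (hat f))\<close>, also for a symbol \<open>m\<close> that is singular
  at 0.\<close>

definition hdot_norm :: "real \<Rightarrow> ('a::euclidean_space \<Rightarrow> complex) \<Rightarrow> ennreal" where
  "hdot_norm a h = L2_norm (symbol_mult (D_symbol a) h)"

definition half_primitive :: "(real \<Rightarrow> real) \<Rightarrow> real \<Rightarrow> real" where
  "half_primitive g t = 1 / 2 * integral {0..t} g"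

text \<open>Solutions via the partial Fourier transform in \<open>x\<close>, with \<open>ut\<close> the time derivative of
  \<open>u\<close>. For each \<open>t\<close> the transforms are determined only up to null sets, hence the
  representatives \<open>U\<close>, \<open>V\<close> for which the ordinary differential equation holds at almost
  every frequency.\<close>

definition sobolev_solution ::
    "(real \<Rightarrow> real) \<Rightarrow> (real \<Rightarrow> real) \<Rightarrow> 'a::euclidean_space distribution \<Rightarrow> 'a distribution \<Rightarrow>
     (real \<Rightarrow> 'a distribution) \<Rightarrow> (real \<Rightarrow> 'a distribution) \<Rightarrow> bool" where
  "sobolev_solution b g u0 u1 u ut \<longleftrightarrow>
     (\<exists>h. has_fourier_transform u0 h) \<and> (\<exists>h. has_fourier_transform u1 h) \<and>
     (\<forall>t\<ge>0. (\<exists>h. has_fourier_transform (u t) h) \<and> (\<exists>h. has_fourier_transform (ut t) h)) \<and>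
     (\<exists>U V.
        (\<forall>t\<ge>0. AE \<xi> in lborel. U t \<xi> = hat (u t) \<xi> \<and> V t \<xi> = hat (ut t) \<xi>) \<and>
        (AE \<xi> in lborel. U 0 \<xi> = hat u0 \<xi> \<and> V 0 \<xi> = hat u1 \<xi> \<and>
          (\<forall>t\<ge>0.
            ((\<lambda>s. U s \<xi>) has_vector_derivative V t \<xi>) (at t within {0..}) \<and>
            ((\<lambda>s. V s \<xi>) has_vector_derivative
               - (of_real ((norm \<xi>)\<^sup>2) * U t \<xi>
                  + of_real (b t + g t * (norm \<xi>)\<^sup>2) * V t \<xi>)) (at t within {0..}))))"

end

theory Submission
  imports Defs "HOL-Probability.Characteristic_Functions" "HOL-Probability.Sinc_Integral"
begin

text \<open>On the Fourier side the equation decouples into one linear ordinary differential equation for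
  each frequency \<open>\<xi>\<close>, and the estimates are pointwise bounds for its solution with constants that
  do not depend on \<open>\<xi>\<close>.

  Fix \<open>r = \<bar>\<xi>\<bar>\<close> and let \<open>P\<close> be the primitive of the damping \<open>b + g r\<^sup>2\<close> and \<open>Q\<close> the primitive of
  \<open>exp (- P)\<close>, both vanishing at 0. Eliminating the velocity by variation of constants and integrating
  once more gives a Volterra equation
  \<open>U t = U 0 + Q t V 0 - \<integral>\<^sub>0\<^sup>t k(s, t) U s ds\<close> with \<open>k(s, t) = r\<^sup>2 (Q t - Q s) exp (P s)\<close>.
  Since \<open>g\<close> increases, the part \<open>g r\<^sup>2\<close> of the damping alone forces \<open>k(s, t) \<le> 1 / g s\<close>, which is
  integrable in time. So Gronwall's inequality costs only a factor \<open>exp (\<integral> 1 / g)\<close>, uniformly in the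
  frequency. The weight \<open>1 / (1 + r\<^sup>2)\<close> of the initial velocity comes from \<open>Q\<close>: it is bounded because
  \<open>s b s \<ge> 2\<close> for large \<open>s\<close> makes \<open>exp (- P)\<close> decay like \<open>s\<^sup>-\<^sup>2\<close>, and \<open>r\<^sup>2 Q\<close> is bounded by the kernel
  estimate at \<open>s = 0\<close>. The velocity then satisfies \<open>\<bar>V t\<bar> \<le> \<bar>V 0\<bar> + r\<^sup>2 t sup \<bar>U\<bar>\<close>, and \<open>t\<close> is at most a
  multiple of \<open>g t\<close>, again because \<open>1 / g\<close> is integrable and decreasing. These bounds are collected in
  \<open>mode_bounds\<close>. The two estimates of the velocity differ only in how \<open>\<bar>V 0\<bar>\<close> is bounded: by a
  multiple of \<open>(b t + g t r\<^sup>2) \<bar>V 0\<bar> / (1 + r\<^sup>2)\<close> when \<open>b\<close> increases, and of \<open>g t \<bar>V 0\<bar>\<close> when it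
  decreases.

  To return to physical space one needs that a distribution whose Fourier transform is a
  square-integrable function \<open>h\<close> is itself given by a function with at most the norm of \<open>h\<close>. For
  integrable \<open>h\<close> this is Plancherel's inequality (\<open>plancherel_inequality\<close>), obtained by inserting a
  Gaussian factor: its Fourier transform is a probability density, so the regularised square
  integral of the transform is a quadratic form in \<open>h\<close> bounded by Young's inequality. In general
  (\<open>L2_inv_fourier_exists\<close>) one truncates \<open>h\<close> to balls and passes to an \<open>L\<^sup>2\<close> limit.\<close>

section \<open>Calculus on the half-line\<close>

lemma has_vector_derivative_half_line_interior:
  assumes "(f has_vector_derivative f') (at x within {a..})" and "a < x"
  shows "(f has_vector_derivative f') (at x)"
proof -
  have "at x within {a..} = at x"
    using assms(2) by (intro at_within_interior) (simp add: interior_real_atLeast)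
  with assms(1) show ?thesis by simp
qed

lemma half_line_norm_increment_le:
  fixes f :: "real \<Rightarrow> 'a::real_normed_vector" and F :: "real \<Rightarrow> real"
  assumes f: "\<And>s. s \<ge> 0 \<Longrightarrow> (f has_vector_derivative f' s) (at s within {0..})"
    and F: "\<And>s. s \<ge> 0 \<Longrightarrow> (F has_real_derivative F' s) (at s within {0..})"
    and le: "\<And>s. \<lbrakk>0 \<le> s; s \<le> t\<rbrakk> \<Longrightarrow> norm (f' s) \<le> F' s" and t: "0 \<le> t"
  shows "norm (f t - f 0) \<le> F t - F 0"
proof (cases "t = 0")
  case False
  have F': "(F has_vector_derivative F' s) (at s within {0..})" if "s \<ge> 0" for s
    using F[OF that] by (simp add: has_real_derivative_iff_has_vector_derivative)
  have "continuous_on {0..} f" "continuous_on {0..} F"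
    using f F' by (auto intro: continuous_on_vector_derivative)
  then have "continuous_on {0..t} f" "continuous_on {0..t} F"
    by (auto elim: continuous_on_subset)
  then show ?thesis
    using False t le has_vector_derivative_half_line_interior[OF f]
      has_vector_derivative_half_line_interior[OF F']
    by (intro differentiable_bound_general[where f' = f' and \<phi>' = F']) auto
qed auto

lemma half_line_mono:
  fixes f :: "real \<Rightarrow> real"
  assumes f: "\<And>s. s \<ge> c \<Longrightarrow> (f has_real_derivative f' s) (at s within {c..})"
    and nonneg: "\<And>s. \<lbrakk>c \<le> s; s \<le> t\<rbrakk> \<Longrightarrow> f' s \<ge> 0" and st: "c \<le> s" "s \<le> t"
  shows "f s \<le> f t"
proof (rule DERIV_nonneg_imp_increasing_open[OF st(2)])
  have f': "(f has_vector_derivative f' s) (at s within {c..})" if "s \<ge> c" for s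
    using f[OF that] by (simp add: has_real_derivative_iff_has_vector_derivative)
  show "\<exists>y. DERIV f x :> y \<and> 0 \<le> y" if "s < x" "x < t" for x
    using has_vector_derivative_half_line_interior[OF f'[of x]] nonneg[of x] st that
    by (auto simp: has_real_derivative_iff_has_vector_derivative)
  have "continuous_on {c..} f"
    using f' by (auto intro: continuous_on_vector_derivative)
  then show "continuous_on {s..t} f"
    by (rule continuous_on_subset) (use st in auto)
qed

lemma integral_has_real_derivative_half_line:
  fixes f :: "real \<Rightarrow> real"
  assumes f: "continuous_on {0..} f" and t: "t \<ge> 0"
  shows "((\<lambda>t. integral {0..t} f) has_real_derivative f t) (at t within {0..})"
proof -
  have "continuous_on {0..t + 1} f"
    using f by (rule continuous_on_subset) auto
  then have "((\<lambda>t. integral {0..t} f) has_vector_derivative f t) (at t within {0..t + 1})"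
    by (rule integral_has_vector_derivative) (use t in auto)
  moreover have "at t within {0..t + 1} = at t within {0..}"
    by (rule at_within_nhd[of _ "{..<t + 1}"]) auto
  ultimately show ?thesis
    by (simp add: has_real_derivative_iff_has_vector_derivative)
qed

text \<open>The right-hand side of the integral inequality, multiplied by \<open>exp (- \<integral> w)\<close>, is nonincreasing.\<close>

lemma gronwall_half_line:
  fixes u w :: "real \<Rightarrow> real"
  assumes u: "continuous_on {0..} u" and w: "continuous_on {0..} w" "\<And>s. s \<ge> 0 \<Longrightarrow> w s \<ge> 0"
    and le: "\<And>s. s \<ge> 0 \<Longrightarrow> u s \<le> c + integral {0..s} (\<lambda>x. w x * u x)"
    and t: "t \<ge> 0"
  shows "u t \<le> c * exp (integral {0..t} w)"
proof -
  define F where "F = (\<lambda>s. integral {0..s} (\<lambda>x. w x * u x))"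
  define H where "H = (\<lambda>s. integral {0..s} w)"
  have F: "(F has_real_derivative w s * u s) (at s within {0..})" if "s \<ge> 0" for s
    unfolding F_def using that
    by (intro integral_has_real_derivative_half_line continuous_on_mult w(1) u)
  have H: "(H has_real_derivative w s) (at s within {0..})" if "s \<ge> 0" for s
    unfolding H_def using that by (intro integral_has_real_derivative_half_line w(1))
  have "- ((c + F 0) * exp (- H 0)) \<le> - ((c + F t) * exp (- H t))"
  proof (rule half_line_mono[where c = 0 and f = "\<lambda>s. - ((c + F s) * exp (- H s))"
        and f' = "\<lambda>s. (w s * (c + F s) - w s * u s) * exp (- H s)"])
    show "((\<lambda>s. - ((c + F s) * exp (- H s))) has_real_derivative
        (w s * (c + F s) - w s * u s) * exp (- H s)) (at s within {0..})" if "s \<ge> 0" for s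
      by (rule derivative_eq_intros F H that refl)+ (simp add: algebra_simps)
    show "(w s * (c + F s) - w s * u s) * exp (- H s) \<ge> 0" if "0 \<le> s" for s
      using mult_left_mono[OF le[OF that] w(2)[OF that]] by (simp add: F_def)
  qed (use t in auto)
  then have "c + F t \<le> c * exp (H t)"
    by (simp add: exp_minus field_simps F_def H_def)
  with le[OF t] show ?thesis by (simp add: F_def H_def)
qed

section \<open>A single frequency\<close>

text \<open>Here \<open>P\<close> is the integrated damping, and \<open>(Q t - Q s) exp (P s)\<close> is the displacement at time \<open>t\<close>
  produced by a unit velocity at time \<open>s\<close> when only the damping acts. The two quantitative bounds compare
  \<open>Q\<close> with an explicit function: \<open>exp (- P) / g\<close> for the kernel, and \<open>s exp (- P s)\<close> for the tail of \<open>Q\<close>.\<close>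

lemma damping_kernel_bounds:
  fixes b g g' P Q :: "real \<Rightarrow> real" and r :: real
  assumes g: "\<And>s. s \<ge> 0 \<Longrightarrow> (g has_real_derivative g' s) (at s within {0..})"
    and g_pos: "\<And>s. s \<ge> 0 \<Longrightarrow> g s > 0 \<and> g' s > 0" and b_pos: "\<And>s. s \<ge> 0 \<Longrightarrow> b s > 0"
    and T: "T > 0" "\<And>s. s \<ge> T \<Longrightarrow> s * b s \<ge> 2"
    and P: "P 0 = 0"
      "\<And>s. s \<ge> 0 \<Longrightarrow> (P has_real_derivative b s + g s * r\<^sup>2) (at s within {0..})"
    and Q: "Q 0 = 0" "\<And>s. s \<ge> 0 \<Longrightarrow> (Q has_real_derivative exp (- P s)) (at s within {0..})"
  shows damping_kernel_le: "\<lbrakk>0 \<le> s; s \<le> t\<rbrakk> \<Longrightarrow> r\<^sup>2 * (Q t - Q s) * exp (P s) \<le> 1 / g s"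
    and damping_kernel_total_le: "t \<ge> 0 \<Longrightarrow> (1 + r\<^sup>2) * Q t \<le> 2 * T + 1 / g 0"
    and damping_kernel_mono: "\<lbrakk>0 \<le> s; s \<le> t\<rbrakk> \<Longrightarrow> Q s \<le> Q t"
    and damping_exponent_mono: "\<lbrakk>0 \<le> s; s \<le> t\<rbrakk> \<Longrightarrow> P s \<le> P t"
proof -
  have D_pos: "b s + g s * r\<^sup>2 > 0" if "s \<ge> 0" for s
    using b_pos[OF that] g_pos[OF that] by (simp add: add_pos_nonneg)
  have P_mono: "P s \<le> P t" if "0 \<le> s" "s \<le> t" for s t
    by (rule half_line_mono[OF P(2)]) (use that D_pos in \<open>auto intro: less_imp_le\<close>)
  then show "\<lbrakk>0 \<le> s; s \<le> t\<rbrakk> \<Longrightarrow> P s \<le> P t" .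
  have Q_mono: "Q s \<le> Q t" if "0 \<le> s" "s \<le> t" for s t
    by (rule half_line_mono[OF Q(2)]) (use that in auto)
  then show "\<lbrakk>0 \<le> s; s \<le> t\<rbrakk> \<Longrightarrow> Q s \<le> Q t" .
  have kernel: "r\<^sup>2 * (Q t - Q s) * exp (P s) \<le> 1 / g s" if st: "0 \<le> s" "s \<le> t" for s t
  proof -
    \<comment> \<open>At \<open>s = t\<close> this difference is negative, and it increases up to there because the damping
      is at least \<open>g r\<^sup>2\<close> and \<open>g\<close> increases.\<close>
    have "r\<^sup>2 * (Q t - Q s) - exp (- P s) / g s \<le> r\<^sup>2 * (Q t - Q t) - exp (- P t) / g t"
    proof (rule half_line_mono[OF _ _ st, where f = "\<lambda>s. r\<^sup>2 * (Q t - Q s) - exp (- P s) / g s"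
          and f' = "\<lambda>x. exp (- P x) * (b x / g x + g' x / (g x)\<^sup>2)"])
      fix x :: real assume x: "x \<ge> 0"
      have "((\<lambda>s. exp (- P s)) has_real_derivative - (b x + g x * r\<^sup>2) * exp (- P x)) (at x within {0..})"
        by (rule derivative_eq_intros P(2)[OF x] refl)+ simp
      from DERIV_diff[OF DERIV_cmult[OF DERIV_diff[OF DERIV_const Q(2)[OF x]]] DERIV_divide[OF this g[OF x]]]
      show "((\<lambda>s. r\<^sup>2 * (Q t - Q s) - exp (- P s) / g s) has_real_derivative
          exp (- P x) * (b x / g x + g' x / (g x)\<^sup>2)) (at x within {0..})"
        by (rule DERIV_cong) (use g_pos[OF x] in \<open>auto simp: field_simps power2_eq_square\<close>)
      show "exp (- P x) * (b x / g x + g' x / (g x)\<^sup>2) \<ge> 0"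
        using g_pos[OF x] b_pos[OF x] by simp
    qed
    moreover have "exp (- P t) / g t \<ge> 0" using g_pos[of t] st by simp
    ultimately have "r\<^sup>2 * (Q t - Q s) \<le> exp (- P s) / g s"
      by simp
    then have "r\<^sup>2 * (Q t - Q s) * exp (P s) \<le> exp (- P s) / g s * exp (P s)"
      by (intro mult_right_mono) auto
    then show ?thesis by (simp add: exp_minus)
  qed
  then show "\<lbrakk>0 \<le> s; s \<le> t\<rbrakk> \<Longrightarrow> r\<^sup>2 * (Q t - Q s) * exp (P s) \<le> 1 / g s" .
  have exp_le: "exp (- P s) \<le> 1" if "s \<ge> 0" for s
    using P_mono[of 0 s] P(1) that by simp
  have Q_T: "Q T \<le> T"
    using half_line_norm_increment_le[of Q "\<lambda>s. exp (- P s)" "\<lambda>s. s" "\<lambda>_. 1" T] T(1) Q exp_le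
    by (auto simp: has_real_derivative_iff_has_vector_derivative[symmetric] intro!: derivative_eq_intros)
  have "Q t \<le> 2 * T" if t: "t \<ge> 0" for t
  proof (cases "t \<le> T")
    case True
    with Q_mono[OF t True] Q_T T(1) show ?thesis by simp
  next
    case False
    \<comment> \<open>From time \<open>T\<close> on \<open>Q s + s exp (- P s)\<close> is nonincreasing, as \<open>s b s \<ge> 2\<close>.\<close>
    have "- (Q T + T * exp (- P T)) \<le> - (Q t + t * exp (- P t))"
    proof (rule half_line_mono[where c = T and f = "\<lambda>s. - (Q s + s * exp (- P s))"
          and f' = "\<lambda>x. exp (- P x) * (x * (b x + g x * r\<^sup>2) - 2)"])
      fix x :: real assume "T \<le> x"
      then have x: "x \<ge> 0" "x * b x \<ge> 2" using T by auto
      have sub: "{T..} \<subseteq> {0..}" using T by auto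
      show "((\<lambda>s. - (Q s + s * exp (- P s))) has_real_derivative
          exp (- P x) * (x * (b x + g x * r\<^sup>2) - 2)) (at x within {T..})"
        by (rule derivative_eq_intros DERIV_subset[OF Q(2)[OF x(1)] sub]
            DERIV_subset[OF P(2)[OF x(1)] sub] refl)+
          (simp add: algebra_simps)
      have "x * (g x * r\<^sup>2) \<ge> 0" using g_pos[OF x(1)] x by simp
      with x show "exp (- P x) * (x * (b x + g x * r\<^sup>2) - 2) \<ge> 0"
        by (simp add: distrib_left)
    qed (use False in auto)
    moreover have "T * exp (- P T) \<le> T * 1"
      by (intro mult_left_mono exp_le) (use T in auto)
    moreover have "t * exp (- P t) \<ge> 0" using t by simp
    ultimately show ?thesis using Q_T by simp
  qed
  moreover have "r\<^sup>2 * Q t \<le> 1 / g 0" if "t \<ge> 0" for t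
    using kernel[of 0 t] that P(1) Q(1) by simp
  ultimately show "t \<ge> 0 \<Longrightarrow> (1 + r\<^sup>2) * Q t \<le> 2 * T + 1 / g 0"
    by (simp add: distrib_right add_mono)
qed

text \<open>The uniform bounds for one frequency of size \<open>r\<close>. For the displacement the quantity
  \<open>Z s = U s + (Q t - Q s) exp (P s) V s\<close> is used: it interpolates between \<open>U 0 + Q t V 0\<close> at \<open>s = 0\<close> and
  \<open>U t\<close> at \<open>s = t\<close>, and its derivative \<open>- r\<^sup>2 (Q t - Q s) exp (P s) U s\<close> contains no velocity. For the
  velocity, \<open>exp P V\<close> has the derivative \<open>- r\<^sup>2 exp P U\<close>.\<close>

lemma mode_bounds:
  fixes b g g' :: "real \<Rightarrow> real" and U V :: "real \<Rightarrow> complex" and r :: real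
  assumes g: "\<And>s. s \<ge> 0 \<Longrightarrow> (g has_real_derivative g' s) (at s within {0..})"
    and g_pos: "\<And>s. s \<ge> 0 \<Longrightarrow> g s > 0 \<and> g' s > 0"
    and b: "continuous_on {0..} b" and b_pos: "\<And>s. s \<ge> 0 \<Longrightarrow> b s > 0"
    and T: "T > 0" "\<And>s. s \<ge> T \<Longrightarrow> s * b s \<ge> 2"
    and L: "\<And>s. s \<ge> 0 \<Longrightarrow> integral {0..s} (\<lambda>x. 1 / g x) \<le> L"
    and U: "\<And>s. s \<ge> 0 \<Longrightarrow> (U has_vector_derivative V s) (at s within {0..})"
    and V: "\<And>s. s \<ge> 0 \<Longrightarrow> (V has_vector_derivative
        - (of_real (r\<^sup>2) * U s + of_real (b s + g s * r\<^sup>2) * V s)) (at s within {0..})"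
    and t: "t \<ge> 0"
  defines "M \<equiv> (norm (U 0) + (2 * T + 1 / g 0) * (norm (V 0) / (1 + r\<^sup>2))) * exp L"
  shows mode_displacement_le: "norm (U t) \<le> M"
    and mode_velocity_le: "norm (V t) \<le> norm (V 0) + r\<^sup>2 * M * t"
proof -
  have contg: "continuous_on {0..} g" using g by (auto intro: DERIV_continuous_on)
  have "continuous_on {0..} (\<lambda>s. b s + g s * r\<^sup>2)"
    by (intro continuous_intros b contg)
  note P_deriv = integral_has_real_derivative_half_line[OF this]
  define P where "P = (\<lambda>t. integral {0..t} (\<lambda>s. b s + g s * r\<^sup>2))"
  have P: "P 0 = 0"
      "\<And>s. s \<ge> 0 \<Longrightarrow> (P has_real_derivative b s + g s * r\<^sup>2) (at s within {0..})"
    using P_deriv by (simp_all add: P_def)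
  have contP: "continuous_on {0..} P" by (rule DERIV_continuous_on) (use P(2) in auto)
  have "continuous_on {0..} (\<lambda>s. exp (- P s))"
    by (intro continuous_intros contP)
  note Q_deriv = integral_has_real_derivative_half_line[OF this]
  define Q where "Q = (\<lambda>t. integral {0..t} (\<lambda>s. exp (- P s)))"
  have Q: "Q 0 = 0"
      "\<And>s. s \<ge> 0 \<Longrightarrow> (Q has_real_derivative exp (- P s)) (at s within {0..})"
    using Q_deriv by (simp_all add: Q_def)
  have kernel: "r\<^sup>2 * (Q t - Q s) * exp (P s) \<le> 1 / g s" "Q s \<le> Q t" "P s \<le> P t"
    if "0 \<le> s" "s \<le> t" for s t
    using that damping_kernel_bounds[where b = b and g = g and r = r and P = P and Q = Q,
        OF g g_pos b_pos T P Q]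
    by auto
  have kernel_total: "(1 + r\<^sup>2) * Q t \<le> 2 * T + 1 / g 0" if "t \<ge> 0" for t
    using that damping_kernel_total_le[where b = b and g = g and r = r and P = P and Q = Q,
        OF g g_pos b_pos T P Q]
    by auto
  have expP: "((\<lambda>s. exp (P s)) has_real_derivative (b s + g s * r\<^sup>2) * exp (P s)) (at s within {0..})"
    if "s \<ge> 0" for s
    by (rule derivative_eq_intros P(2) that refl)+ simp
  have expP_V: "((\<lambda>s. of_real (exp (P s)) * V s) has_vector_derivative
      - of_real (r\<^sup>2 * exp (P s)) * U s) (at s within {0..})" if "s \<ge> 0" for s
    by (rule derivative_eq_intros has_vector_derivative_of_real expP V that refl)+
      (simp add: algebra_simps)
  have contU: "continuous_on {0..} (\<lambda>s. norm (U s))"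
    using U by (intro continuous_on_norm) (auto intro: continuous_on_vector_derivative)
  have contg': "continuous_on {0..} (\<lambda>s. 1 / g s)"
    by (intro continuous_intros contg) (metis atLeast_iff g_pos less_irrefl)
  have bound: "norm (U t) \<le> M" if t: "t \<ge> 0" for t
  proof -
    have "norm (U t) \<le> (norm (U 0) + (2 * T + 1 / g 0) * (norm (V 0) / (1 + r\<^sup>2)))
        * exp (integral {0..t} (\<lambda>s. 1 / g s))"
    proof (rule gronwall_half_line[OF contU contg' _ _ t])
      show "1 / g s \<ge> 0" if "s \<ge> 0" for s using g_pos[OF that] by simp
      fix t :: real assume t: "t \<ge> 0"
      define F where "F = (\<lambda>t. integral {0..t} (\<lambda>s. 1 / g s * norm (U s)))"
      have F: "(F has_real_derivative 1 / g s * norm (U s)) (at s within {0..})" if "s \<ge> 0" for s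
        unfolding F_def
        by (rule integral_has_real_derivative_half_line[OF continuous_on_mult[OF contg' contU] that])
      define Z where "Z = (\<lambda>s. U s + of_real (Q t - Q s) * (of_real (exp (P s)) * V s))"
      have "norm (Z t - Z 0) \<le> F t - F 0"
      proof (rule half_line_norm_increment_le[OF _ F _ t])
        fix s :: real assume s: "s \<ge> 0"
        have "((\<lambda>s. Q t - Q s) has_real_derivative - exp (- P s)) (at s within {0..})"
          by (rule derivative_eq_intros Q(2) s refl)+ simp
        from has_vector_derivative_add[OF U[OF s]
            has_vector_derivative_mult[OF has_vector_derivative_of_real[OF this] expP_V[OF s]]]
        show "(Z has_vector_derivative - of_real (r\<^sup>2 * (Q t - Q s) * exp (P s)) * U s)
            (at s within {0..})"
          unfolding Z_def
          by (rule has_vector_derivative_eq_rhs) (simp add: algebra_simps exp_minus)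
      next
        fix s :: real assume s: "0 \<le> s" "s \<le> t"
        have "r\<^sup>2 * (Q t - Q s) * exp (P s) \<ge> 0"
          using kernel(2)[OF s] by simp
        then show "norm (- of_real (r\<^sup>2 * (Q t - Q s) * exp (P s)) * U s) \<le> 1 / g s * norm (U s)"
          using mult_right_mono[OF kernel(1)[OF s] norm_ge_zero[of "U s"]]
          by (simp only: norm_mult norm_minus_cancel norm_of_real abs_of_nonneg)
      qed
      then have "norm (U t - (U 0 + of_real (Q t) * V 0)) \<le> F t"
        using P(1) Q(1) by (simp add: Z_def F_def)
      moreover have "norm (U 0 + of_real (Q t) * V 0) \<le> norm (U 0) + Q t * norm (V 0)"
        using kernel(2)[of 0 t] Q(1) t norm_triangle_ineq[of "U 0" "of_real (Q t) * V 0"]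
        by (simp add: norm_mult)
      moreover have "Q t * norm (V 0) \<le> (2 * T + 1 / g 0) * (norm (V 0) / (1 + r\<^sup>2))"
      proof -
        have r: "1 + r\<^sup>2 > 0" by (simp add: add_pos_nonneg)
        have "Q t \<le> (2 * T + 1 / g 0) / (1 + r\<^sup>2)"
          using kernel_total[OF t] r by (simp add: pos_le_divide_eq mult.commute)
        then show ?thesis
          using mult_right_mono[OF _ norm_ge_zero[of "V 0"]] by fastforce
      qed
      ultimately show "norm (U t) \<le> norm (U 0) + (2 * T + 1 / g 0) * (norm (V 0) / (1 + r\<^sup>2))
          + integral {0..t} (\<lambda>s. 1 / g s * norm (U s))"
        unfolding F_def[THEN fun_cong, symmetric]
        using norm_triangle_sub[of "U t" "U 0 + of_real (Q t) * V 0"] by linarith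
    qed
    also have "\<dots> \<le> M"
      unfolding M_def using L[OF t] g_pos[of 0] T
      by (intro mult_left_mono) (auto intro!: add_nonneg_nonneg mult_nonneg_nonneg)
    finally show ?thesis .
  qed
  from bound[OF t] show "norm (U t) \<le> M" .
  have M: "M \<ge> 0" using bound[of 0] norm_ge_zero[of "U 0"] by linarith
  have "norm (of_real (exp (P t)) * V t - of_real (exp (P 0)) * V 0)
      \<le> r\<^sup>2 * M * exp (P t) * t - r\<^sup>2 * M * exp (P t) * 0"
  proof (rule half_line_norm_increment_le[OF expP_V _ _ t, where F = "\<lambda>s. r\<^sup>2 * M * exp (P t) * s"])
    show "((\<lambda>s. r\<^sup>2 * M * exp (P t) * s) has_real_derivative r\<^sup>2 * M * exp (P t)) (at s within {0..})"
      for s by (rule derivative_eq_intros refl)+ simp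
    fix s :: real assume s: "0 \<le> s" "s \<le> t"
    have "r\<^sup>2 * exp (P s) * norm (U s) \<le> r\<^sup>2 * exp (P t) * M"
      using bound[OF s(1)] kernel(3)[OF s] M by (intro mult_mono) auto
    then show "norm (- of_real (r\<^sup>2 * exp (P s)) * U s) \<le> r\<^sup>2 * M * exp (P t)"
      by (simp add: norm_mult mult_ac norm_power)
  qed
  then have "norm (of_real (exp (P t)) * V t) \<le> norm (V 0) + r\<^sup>2 * M * exp (P t) * t"
    using P(1) norm_triangle_sub[of "of_real (exp (P t)) * V t" "V 0"] by simp
  then have "exp (P t) * norm (V t) \<le> exp (P t) * (r\<^sup>2 * M * t) + 1 * norm (V 0)"
    by (simp add: norm_mult mult_ac)
  also have "\<dots> \<le> exp (P t) * (r\<^sup>2 * M * t) + exp (P t) * norm (V 0)"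
    using kernel(3)[of 0 t] P(1) t by (intro add_left_mono mult_right_mono) auto
  finally have "exp (P t) * norm (V t) \<le> exp (P t) * (norm (V 0) + r\<^sup>2 * M * t)"
    by (simp add: algebra_simps)
  then show "norm (V t) \<le> norm (V 0) + r\<^sup>2 * M * t" by simp
qed

section \<open>The Fourier transform of a Gaussian\<close>

lemma borel_measurable_cis [measurable]: "cis \<in> borel_measurable borel"
  by (intro borel_measurable_continuous_onI continuous_intros)

text \<open>The characteristic function of the standard normal distribution, rescaled.\<close>

lemma fourier_gaussian_real:
  assumes \<sigma>: "\<sigma> > 0"
  shows "(LINT \<xi>|lborel. cis (z * \<xi>) * of_real (exp (- (\<sigma> * \<xi>)\<^sup>2 / 2)))
    = of_real (2 * pi * normal_density 0 \<sigma> z)"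
    and "integrable lborel (\<lambda>\<xi>. cis (z * \<xi>) * complex_of_real (exp (- (\<sigma> * \<xi>)\<^sup>2 / 2)))"
proof -
  have int: "integrable lborel (\<lambda>\<xi>. complex_of_real (std_normal_density \<xi>))"
    using integrable_normal_density[of 1 0] by (simp add: integrable_of_real)
  have int': "integrable lborel (\<lambda>\<xi>. of_real (std_normal_density \<xi>) * cis (t * \<xi>))" for t
    by (rule Bochner_Integration.integrable_bound[OF int]) (auto simp: norm_mult)
  have scaled: "cis (z * \<xi>) * complex_of_real (exp (- (\<sigma> * \<xi>)\<^sup>2 / 2))
      = of_real (sqrt (2 * pi)) * (of_real (std_normal_density (\<sigma> * \<xi>)) * cis (z / \<sigma> * (\<sigma> * \<xi>)))"
        for \<xi>
    using \<sigma> by (simp add: std_normal_density_def flip: of_real_mult)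
  show "integrable lborel (\<lambda>\<xi>. cis (z * \<xi>) * complex_of_real (exp (- (\<sigma> * \<xi>)\<^sup>2 / 2)))"
    unfolding scaled
    using lborel_integrable_real_affine[OF int'[of "z / \<sigma>"], of \<sigma> 0] \<sigma> by simp
  have "complex_of_real (exp (- (z / \<sigma>)\<^sup>2 / 2)) = char std_normal_distribution (z / \<sigma>)"
    by (simp add: char_std_normal_distribution)
  also have "\<dots> = (LINT \<xi>|lborel. of_real (std_normal_density \<xi>) * cis (z / \<sigma> * \<xi>))"
    unfolding char_def by (subst integral_density) (auto simp: cis_conv_exp scaleR_conv_of_real)
  also have "\<dots> = \<bar>\<sigma>\<bar> *\<^sub>R (LINT \<xi>|lborel. of_real (std_normal_density (0 + \<sigma> * \<xi>)) * cis (z / \<sigma> * (0 + \<sigma> * \<xi>)))"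
    by (rule lborel_integral_real_affine) (use \<sigma> in auto)
  finally have "complex_of_real (exp (- (z / \<sigma>)\<^sup>2 / 2))
    = \<sigma> * (LINT \<xi>|lborel. of_real (std_normal_density (\<sigma> * \<xi>)) * cis (z / \<sigma> * (\<sigma> * \<xi>)))"
    using \<sigma> by (simp add: scaleR_conv_of_real)
  then have eq: "(LINT \<xi>|lborel. of_real (std_normal_density (\<sigma> * \<xi>)) * cis (z / \<sigma> * (\<sigma> * \<xi>)))
      = complex_of_real (exp (- (z / \<sigma>)\<^sup>2 / 2) / \<sigma>)"
    using \<sigma> by (simp add: field_simps)
  have "sqrt (2 * pi) * (exp (- (z / \<sigma>)\<^sup>2 / 2) / \<sigma>) = 2 * pi * normal_density 0 \<sigma> z"
  proof -
    have "sqrt (2 * pi) * sqrt (2 * pi) = 2 * pi" by simp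
    then show ?thesis
      using \<sigma> by (simp add: normal_density_def real_sqrt_mult field_simps power_divide)
  qed
  then show "(LINT \<xi>|lborel. cis (z * \<xi>) * of_real (exp (- (\<sigma> * \<xi>)\<^sup>2 / 2)))
    = of_real (2 * pi * normal_density 0 \<sigma> z)"
    unfolding scaled integral_mult_right_zero eq of_real_mult[symmetric] by (simp only:)
qed

lemma cis_sum: "finite A \<Longrightarrow> cis (\<Sum>i\<in>A. f i) = (\<Prod>i\<in>A. cis (f i))"
  by (induction A rule: finite_induct) (auto simp: cis_mult[symmetric])

text \<open>The density of the centred normal distribution with covariance \<open>\<sigma>\<^sup>2\<close> times the identity.\<close>

definition gaussian_kernel :: "real \<Rightarrow> 'a::euclidean_space \<Rightarrow> real" where
  "gaussian_kernel \<sigma> z = (\<Prod>i\<in>Basis. normal_density 0 \<sigma> (z \<bullet> i))"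

lemma fourier_gaussian:
  fixes z :: "'a::euclidean_space"
  assumes \<sigma>: "\<sigma> > 0"
  shows "(LINT \<xi>|lborel. cis (z \<bullet> \<xi>) * of_real (exp (- (\<sigma> * norm \<xi>)\<^sup>2 / 2)))
    = of_real ((2 * pi) ^ DIM('a) * gaussian_kernel \<sigma> z)"
    and "integrable lborel (\<lambda>\<xi>::'a. exp (- (\<sigma> * norm \<xi>)\<^sup>2 / 2))"
proof -
  interpret product_sigma_finite "\<lambda>_::'a. lborel :: real measure" ..
  define e where "e = (\<lambda>z \<xi>. cis (z * \<xi>) * complex_of_real (exp (- (\<sigma> * \<xi>)\<^sup>2 / 2)))"
  have e: "integrable lborel (e z)" "integral\<^sup>L lborel (e z)
      = of_real (2 * pi * normal_density 0 \<sigma> z)"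
    for z
    using fourier_gaussian_real[OF \<sigma>] by (simp_all add: e_def)
  have "complex_of_real (exp (- (\<sigma> * norm \<xi>)\<^sup>2 / 2))
      = (\<Prod>i\<in>Basis. of_real (exp (- (\<sigma> * (\<xi> \<bullet> i))\<^sup>2 / 2)))"
    for \<xi> :: 'a
  proof -
    have "(norm \<xi>)\<^sup>2 = (\<Sum>i\<in>Basis. (\<xi> \<bullet> i)\<^sup>2)"
      by (simp add: norm_eq_sqrt_inner euclidean_inner[of \<xi> \<xi>] sum_nonneg flip: power2_eq_square)
    then have "- (\<sigma> * norm \<xi>)\<^sup>2 / 2 = (\<Sum>i\<in>Basis. - (\<sigma> * (\<xi> \<bullet> i))\<^sup>2 / 2)"
      by (simp add: power_mult_distrib sum_distrib_left sum_negf flip: sum_divide_distrib)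
    then show ?thesis by (simp add: exp_sum)
  qed
  then have split: "cis (z \<bullet> \<xi>) * complex_of_real (exp (- (\<sigma> * norm \<xi>)\<^sup>2 / 2))
      = (\<Prod>i\<in>Basis. e (z \<bullet> i) (\<xi> \<bullet> i))"
    for z \<xi> :: 'a
    unfolding e_def prod.distrib
    by (subst euclidean_inner) (simp add: cis_sum)
  \<comment> \<open>Lebesgue measure is the image of a product measure under \<open>f \<mapsto> \<Sum>b\<in>Basis. f b *\<^sub>R b\<close>, which
    turns the integral into a product of one-dimensional ones.\<close>
  have sum_Basis: "(\<Prod>i\<in>Basis. e (z \<bullet> i) ((\<Sum>b\<in>Basis. f b *\<^sub>R b) \<bullet> i)) = (\<Prod>i\<in>Basis. e (z \<bullet> i) (f i))"
    for z :: 'a and f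
    by (intro prod.cong refl) (simp add: inner_sum_left_Basis)
  have [measurable]: "e z \<in> borel_measurable borel" for z
    using borel_measurable_integrable[OF e(1)] by simp
  have "integral\<^sup>L lborel (\<lambda>\<xi>::'a. \<Prod>i\<in>Basis. e (z \<bullet> i) (\<xi> \<bullet> i))
      = integral\<^sup>L (\<Pi>\<^sub>M b\<in>Basis. lborel) (\<lambda>f. \<Prod>i\<in>Basis. e (z \<bullet> i) (f i))"
    by (subst lborel_eq, subst integral_distr) (auto simp: sum_Basis)
  also have "\<dots> = (\<Prod>i\<in>Basis. of_real (2 * pi * normal_density 0 \<sigma> (z \<bullet> i)))"
    by (subst product_integral_prod) (auto simp: e)
  finally show "(LINT \<xi>|lborel. cis (z \<bullet> \<xi>) * of_real (exp (- (\<sigma> * norm \<xi>)\<^sup>2 / 2)))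
    = of_real ((2 * pi) ^ DIM('a) * gaussian_kernel \<sigma> z)"
    unfolding split gaussian_kernel_def by (simp add: prod.distrib)
  have "integrable lborel (\<lambda>\<xi>::'a. \<Prod>i\<in>Basis. e (0 \<bullet> i) (\<xi> \<bullet> i))"
    by (subst lborel_eq, subst integrable_distr_eq)
      (auto simp: sum_Basis inner_sum_left_Basis intro!: product_integrable_prod e)
  then have "integrable lborel (\<lambda>\<xi>::'a. complex_of_real (exp (- (\<sigma> * norm \<xi>)\<^sup>2 / 2)))"
    unfolding split[symmetric] by simp
  then show "integrable lborel (\<lambda>\<xi>::'a. exp (- (\<sigma> * norm \<xi>)\<^sup>2 / 2))"
    by (simp add: complex_of_real_integrable_eq del: of_real_exp)
qed

lemma borel_measurable_gaussian_kernel [measurable]: "gaussian_kernel \<sigma> \<in> borel_measurable borel"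
  unfolding gaussian_kernel_def[abs_def] by measurable

lemma gaussian_kernel_nonneg: "gaussian_kernel \<sigma> z \<ge> 0"
  by (auto simp: gaussian_kernel_def intro: prod_nonneg)

lemma gaussian_kernel_minus: "gaussian_kernel \<sigma> (x - y) = gaussian_kernel \<sigma> (y - x)"
  by (auto simp: gaussian_kernel_def normal_density_def inner_diff_left power2_commute)

lemma nn_integral_gaussian_kernel:
  assumes "\<sigma> > 0"
  shows "(\<integral>\<^sup>+z. ennreal (gaussian_kernel \<sigma> (c + z)) \<partial>lborel) = 1"
proof -
  have "(\<integral>\<^sup>+z. ennreal (gaussian_kernel \<sigma> (c + z)) \<partial>lborel)
      = (\<integral>\<^sup>+z. ennreal (gaussian_kernel \<sigma> z) \<partial>distr lborel borel ((+) c))"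
    by (subst nn_integral_distr) auto
  also have "\<dots> = (\<Prod>i\<in>(Basis::'a set). \<integral>\<^sup>+x. ennreal (normal_density 0 \<sigma> x) \<partial>lborel)"
    unfolding lborel_distr_plus gaussian_kernel_def
    by (subst nn_integral_lborel_prod[symmetric]) (auto simp: prod_ennreal)
  also have "(\<integral>\<^sup>+x. ennreal (normal_density 0 \<sigma> x) \<partial>lborel) = 1"
    using assms by (subst nn_integral_eq_integral) auto
  finally show ?thesis by simp
qed

section \<open>Square-integrable functions\<close>

text \<open>Fatou's lemma for \<open>L\<^sup>2\<close> norms.\<close>

lemma nn_integral_norm_square_limit_le:
  fixes v :: "'a \<Rightarrow> complex"
  assumes [measurable]: "\<And>k::nat. u k \<in> borel_measurable M"
    and lim: "AE x in M. (\<lambda>k. u k x) \<longlonglongrightarrow> v x"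
    and bound: "\<forall>\<^sub>F k in sequentially. (\<integral>\<^sup>+x. ennreal ((norm (u k x))\<^sup>2) \<partial>M) \<le> C"
  shows "(\<integral>\<^sup>+x. ennreal ((norm (v x))\<^sup>2) \<partial>M) \<le> C"
proof -
  have "AE x in M. ennreal ((norm (v x))\<^sup>2) = liminf (\<lambda>k. ennreal ((norm (u k x))\<^sup>2))"
    using lim
  proof eventually_elim
    case (elim x)
    then have "(\<lambda>k. ennreal ((norm (u k x))\<^sup>2)) \<longlonglongrightarrow> ennreal ((norm (v x))\<^sup>2)"
      by (intro tendsto_ennrealI tendsto_intros)
    then show ?case by (intro lim_imp_Liminf[symmetric]) auto
  qed
  then have "(\<integral>\<^sup>+x. ennreal ((norm (v x))\<^sup>2) \<partial>M)
      = (\<integral>\<^sup>+x. liminf (\<lambda>k. ennreal ((norm (u k x))\<^sup>2)) \<partial>M)"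
    by (rule nn_integral_cong_AE)
  also have "\<dots> \<le> liminf (\<lambda>k. \<integral>\<^sup>+x. ennreal ((norm (u k x))\<^sup>2) \<partial>M)"
    by (intro nn_integral_liminf) auto
  also have "\<dots> \<le> C" by (intro Liminf_le bound) auto
  finally show ?thesis .
qed

text \<open>Young's inequality. The free weight \<open>e\<close> replaces the Cauchy-Schwarz inequality below: \<open>L\<^sup>2\<close> pairings
  are estimated with a weight adapted to the rate of convergence.\<close>

lemma norm_mult_le_weighted:
  fixes x y :: complex and e :: real
  assumes e: "e > 0"
  shows "norm (x * y) \<le> 1 / e * (norm x)\<^sup>2 + e * (norm y)\<^sup>2"
proof -
  have "0 \<le> (norm x - e * norm y)\<^sup>2 + (norm x)\<^sup>2 + (e * norm y)\<^sup>2" by simp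
  then have "e * (norm x * norm y) \<le> (norm x)\<^sup>2 + e\<^sup>2 * (norm y)\<^sup>2"
    by (simp add: power2_eq_square algebra_simps)
  also have "\<dots> = e * (1 / e * (norm x)\<^sup>2 + e * (norm y)\<^sup>2)"
    using e by (simp add: field_simps power2_eq_square)
  finally show ?thesis using e by (simp add: norm_mult)
qed

lemma ennreal_sum_of_products:
  "\<lbrakk>0 \<le> a; 0 \<le> b; 0 \<le> c; 0 \<le> d\<rbrakk>
    \<Longrightarrow> ennreal a * ennreal b + ennreal c * ennreal d = ennreal (a * b + c * d)"
  by (simp add: ennreal_mult)

lemma nn_integral_mult_le_weighted:
  fixes f g :: "'a \<Rightarrow> complex"
  assumes [measurable]: "f \<in> borel_measurable M" "g \<in> borel_measurable M" and e: "e > 0"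
  shows "(\<integral>\<^sup>+x. ennreal (norm (f x * g x)) \<partial>M)
    \<le> ennreal (1 / e) * (\<integral>\<^sup>+x. ennreal ((norm (f x))\<^sup>2) \<partial>M)
    + ennreal e * (\<integral>\<^sup>+x. ennreal ((norm (g x))\<^sup>2) \<partial>M)"
proof -
  have "(\<integral>\<^sup>+x. ennreal (norm (f x * g x)) \<partial>M)
      \<le> (\<integral>\<^sup>+x. ennreal (1 / e) * ennreal ((norm (f x))\<^sup>2) + ennreal e * ennreal ((norm (g x))\<^sup>2) \<partial>M)"
  proof (rule nn_integral_mono)
    fix x
    have "ennreal (norm (f x * g x)) \<le> ennreal (1 / e * (norm (f x))\<^sup>2 + e * (norm (g x))\<^sup>2)"
      by (rule ennreal_leI[OF norm_mult_le_weighted[OF e]])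
    then show "ennreal (norm (f x * g x))
        \<le> ennreal (1 / e) * ennreal ((norm (f x))\<^sup>2) + ennreal e * ennreal ((norm (g x))\<^sup>2)"
      by (subst ennreal_sum_of_products) (use e in auto)
  qed
  also have "\<dots> = ennreal (1 / e) * (\<integral>\<^sup>+x. ennreal ((norm (f x))\<^sup>2) \<partial>M)
      + ennreal e * (\<integral>\<^sup>+x. ennreal ((norm (g x))\<^sup>2) \<partial>M)"
    by (simp add: nn_integral_add nn_integral_cmult)
  finally show ?thesis .
qed

lemma integrable_mult_L2:
  fixes f g :: "'a \<Rightarrow> complex"
  assumes m: "f \<in> borel_measurable M" "g \<in> borel_measurable M"
    and fin: "(\<integral>\<^sup>+x. ennreal ((norm (f x))\<^sup>2) \<partial>M) < \<infinity>" "(\<integral>\<^sup>+x. ennreal ((norm (g x))\<^sup>2) \<partial>M) < \<infinity>"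
  shows "integrable M (\<lambda>x. f x * g x)"
proof (rule integrableI_bounded)
  show "(\<lambda>x. f x * g x) \<in> borel_measurable M" using m by measurable
  have "(\<integral>\<^sup>+x. ennreal (norm (f x * g x)) \<partial>M)
      \<le> (\<integral>\<^sup>+x. ennreal ((norm (f x))\<^sup>2) \<partial>M) + (\<integral>\<^sup>+x. ennreal ((norm (g x))\<^sup>2) \<partial>M)"
    using nn_integral_mult_le_weighted[OF m zero_less_one] by simp
  also have "\<dots> < \<infinity>" using fin by simp
  finally show "(\<integral>\<^sup>+x. ennreal (norm (f x * g x)) \<partial>M) < \<infinity>" .
qed

lemma L2_pairing_tendsto:
  fixes f \<psi> :: "'a \<Rightarrow> complex"
  assumes m [measurable]: "f \<in> borel_measurable M" "\<And>k::nat. s k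
      \<in> borel_measurable M" "\<psi> \<in> borel_measurable M"
    and f: "(\<integral>\<^sup>+x. ennreal ((norm (f x))\<^sup>2) \<partial>M) < \<infinity>"
    and s: "\<And>k. (\<integral>\<^sup>+x. ennreal ((norm (s k x))\<^sup>2) \<partial>M) < \<infinity>"
    and \<psi>: "(\<integral>\<^sup>+x. ennreal ((norm (\<psi> x))\<^sup>2) \<partial>M) < \<infinity>"
    and close: "\<And>k. (\<integral>\<^sup>+x. ennreal ((norm (f x - s k x))\<^sup>2) \<partial>M) \<le> ennreal ((1 / 4) ^ k)"
  shows "(\<lambda>k. LINT x|M. s k x * \<psi> x) \<longlonglongrightarrow> (LINT x|M. f x * \<psi> x)"
proof (rule metric_LIMSEQ_I)
  obtain A where A: "A \<ge> 0" "(\<integral>\<^sup>+x. ennreal ((norm (\<psi> x))\<^sup>2) \<partial>M) = ennreal A"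
    using \<psi> by (metis ennreal_cases infinity_ennreal_def less_irrefl)
  have bound: "dist (LINT x|M. s k x * \<psi> x) (LINT x|M. f x * \<psi> x) \<le> (1 / 2) ^ k * (1 + A)" for k
  proof -
    have i: "integrable M (\<lambda>x. s k x * \<psi> x)" "integrable M (\<lambda>x. f x * \<psi> x)"
      using f s \<psi> by (auto intro!: integrable_mult_L2)
    have "ennreal (dist (LINT x|M. s k x * \<psi> x) (LINT x|M. f x * \<psi> x))
        = ennreal (norm (LINT x|M. (f x - s k x) * \<psi> x))"
      using i by (simp add: dist_norm left_diff_distrib norm_minus_commute)
    also have "\<dots> \<le> (\<integral>\<^sup>+x. ennreal (norm ((f x - s k x) * \<psi> x)) \<partial>M)"
      by (rule integral_norm_bound_ennreal) (use i in \<open>simp add: left_diff_distrib\<close>)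
    \<comment> \<open>The weight \<open>2\<^sup>-\<^sup>k\<close> balances the squared distance \<open>4\<^sup>-\<^sup>k\<close>; both terms become \<open>O(2\<^sup>-\<^sup>k)\<close>.\<close>
    also have "\<dots> \<le> ennreal (1 / (1 / 2) ^ k) * (\<integral>\<^sup>+x. ennreal ((norm (f x - s k x))\<^sup>2) \<partial>M)
        + ennreal ((1 / 2) ^ k) * (\<integral>\<^sup>+x. ennreal ((norm (\<psi> x))\<^sup>2) \<partial>M)"
      by (rule nn_integral_mult_le_weighted) auto
    also have "\<dots> \<le> ennreal (1 / (1 / 2) ^ k) * ennreal ((1 / 4) ^ k)
        + ennreal ((1 / 2) ^ k) * ennreal A"
      unfolding A(2) by (intro add_right_mono mult_left_mono close) auto
    also have "\<dots> = ennreal (1 / (1 / 2) ^ k * (1 / 4) ^ k + (1 / 2) ^ k * A)"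
      by (rule ennreal_sum_of_products) (use A(1) in auto)
    also have "1 / (1 / 2) ^ k * (1 / 4) ^ k + (1 / 2) ^ k * A = (1 / 2) ^ k * (1 + A)"
      by (simp add: field_simps flip: power_mult_distrib)
    finally show ?thesis
      using A(1) by (simp add: ennreal_le_iff)
  qed
  fix e :: real assume e: "e > 0"
  have "(\<lambda>k. (1 / 2) ^ k * (1 + A)) \<longlonglongrightarrow> 0 * (1 + A)"
    by (intro tendsto_intros LIMSEQ_realpow_zero) auto
  then have "\<forall>\<^sub>F k in sequentially. (1 / 2) ^ k * (1 + A) < e"
    using e by (auto dest: order_tendstoD)
  then show "\<exists>no. \<forall>n\<ge>no. dist (LINT x|M. s n x * \<psi> x) (LINT x|M. f x * \<psi> x) < e"
    unfolding eventually_sequentially using bound by (meson le_less_trans)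
qed

text \<open>The core of the completeness of \<open>L\<^sup>2\<close>: the weighted sum of the squared increments with weights \<open>2\<^sup>k\<close>
  has finite integral, hence is finite almost everywhere, and by Young's inequality it dominates the
  sum of the increments themselves.\<close>

lemma AE_convergent_fast_L2_Cauchy:
  fixes s :: "nat \<Rightarrow> 'a \<Rightarrow> complex"
  assumes [measurable]: "\<And>k. s k \<in> borel_measurable M"
    and fast: "\<And>k. (\<integral>\<^sup>+x. ennreal ((norm (s (Suc k) x - s k x))\<^sup>2) \<partial>M) \<le> ennreal ((1 / 4) ^ k)"
  shows "AE x in M. convergent (\<lambda>k. s k x)"
proof -
  define d where "d = (\<lambda>k x. 2 ^ k * (norm (s (Suc k) x - s k x))\<^sup>2)"
  have [measurable]: "d k \<in> borel_measurable M" for k unfolding d_def by measurable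
  have "(\<integral>\<^sup>+x. (\<Sum>k. ennreal (d k x)) \<partial>M) = (\<Sum>k. \<integral>\<^sup>+x. ennreal (d k x) \<partial>M)"
    by (rule nn_integral_suminf) measurable
  also have "\<dots> \<le> (\<Sum>k. ennreal ((1 / 2) ^ k))"
  proof (intro suminf_le)
    fix k
    have "(\<integral>\<^sup>+x. ennreal (d k x) \<partial>M)
        = ennreal (2 ^ k) * (\<integral>\<^sup>+x. ennreal ((norm (s (Suc k) x - s k x))\<^sup>2) \<partial>M)"
      unfolding d_def by (subst nn_integral_cmult[symmetric]) (auto simp: ennreal_mult)
    also have "\<dots> \<le> ennreal (2 ^ k) * ennreal ((1 / 4) ^ k)" by (intro mult_left_mono fast) auto
    also have "\<dots> = ennreal ((1 / 2) ^ k)"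
      by (simp flip: ennreal_mult power_mult_distrib)
    finally show "(\<integral>\<^sup>+x. ennreal (d k x) \<partial>M) \<le> ennreal ((1 / 2) ^ k)" .
  qed auto
  also have "\<dots> < \<infinity>"
    by (subst suminf_ennreal2) (auto intro: summable_geometric)
  finally have "AE x in M. (\<Sum>k. ennreal (d k x)) \<noteq> \<infinity>"
    by (intro nn_integral_noteq_infinite) (auto simp: less_top)
  then show ?thesis
  proof eventually_elim
    case (elim x)
    have "summable (\<lambda>k. d k x)"
      using elim by (intro summable_suminf_not_top) (auto simp: d_def)
    then have "summable (\<lambda>k. d k x + (1 / 2) ^ k)"
      by (intro summable_add summable_geometric) auto
    moreover have "norm (s (Suc k) x - s k x) \<le> d k x + (1 / 2) ^ k" for k
      using norm_mult_le_weighted[of "(1 / 2) ^ k" "s (Suc k) x - s k x" 1]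
      by (simp add: d_def power_one_over)
    ultimately have "summable (\<lambda>k. s (Suc k) x - s k x)"
      by (rule summable_comparison_test'[where N = 0])
    then have "convergent (\<lambda>n. s n x - s 0 x)"
      unfolding summable_iff_convergent sum_lessThan_telescope[of "\<lambda>k. s k x"] .
    then have "convergent (\<lambda>n. (s n x - s 0 x) + s 0 x)"
      by (rule convergent_add[OF _ convergent_const])
    then show ?case by simp
  qed
qed

section \<open>Plancherel's inequality\<close>

lemma borel_measurable_cnj [measurable]: "cnj \<in> borel_measurable borel"
  by (intro borel_measurable_continuous_onI continuous_intros)

lemma (in pair_sigma_finite) integrable_product_mult:
  fixes f :: "'a \<Rightarrow> complex" and g :: "'b \<Rightarrow> complex"
  assumes f: "integrable M1 f" and g: "integrable M2 g"
  shows "integrable (M1 \<Otimes>\<^sub>M M2) (\<lambda>p. f (fst p) * g (snd p))"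
proof (rule Fubini_integrable)
  have [measurable]: "f \<in> borel_measurable M1" "g \<in> borel_measurable M2"
    using f g by auto
  show "(\<lambda>p. f (fst p) * g (snd p)) \<in> borel_measurable (M1 \<Otimes>\<^sub>M M2)" by measurable
  show "integrable M1 (\<lambda>x. LINT y|M2. norm (f (fst (x, y)) * g (snd (x, y))))"
    using f by (simp add: norm_mult)
  show "AE x in M1. integrable M2 (\<lambda>y. f (fst (x, y)) * g (snd (x, y)))"
    using g by simp
qed

lemma integrable_cis_mult:
  assumes "integrable M f" and [measurable]: "\<theta> \<in> borel_measurable M"
  shows "integrable M (\<lambda>x. cis (\<theta> x) * f x)"
proof (rule Bochner_Integration.integrable_bound[OF assms(1)])
  have [measurable]: "f \<in> borel_measurable M" using assms by auto
  show "(\<lambda>x. cis (\<theta> x) * f x) \<in> borel_measurable M" by measurable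
qed (simp add: norm_mult)

lemma borel_measurable_inv_fourier [measurable]:
  fixes h :: "'a::euclidean_space \<Rightarrow> complex"
  assumes [measurable]: "h \<in> borel_measurable borel"
  shows "inv_fourier h \<in> borel_measurable borel"
  unfolding inv_fourier_def[abs_def] by measurable

lemma inv_fourier_diff:
  fixes h k :: "'a::euclidean_space \<Rightarrow> complex"
  assumes "integrable lborel h" "integrable lborel k"
  shows "inv_fourier (\<lambda>\<xi>. h \<xi> - k \<xi>) x = inv_fourier h x - inv_fourier k x"
proof -
  have "integrable lborel (\<lambda>\<xi>. cis (x \<bullet> \<xi>) * h \<xi>)" "integrable lborel (\<lambda>\<xi>. cis (x \<bullet> \<xi>) * k \<xi>)"
    using assms by (auto intro!: integrable_cis_mult)
  then show ?thesis by (simp add: inv_fourier_def right_diff_distrib)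
qed

lemma inv_fourier_pairing:
  fixes h \<psi> :: "'a::euclidean_space \<Rightarrow> complex"
  assumes h: "integrable lborel h" and \<psi>: "integrable lborel \<psi>"
  shows "(LINT \<xi>|lborel. h \<xi> * inv_fourier \<psi> \<xi>) = (LINT x|lborel. inv_fourier h x * \<psi> x)"
proof -
  have "integrable (lborel \<Otimes>\<^sub>M lborel) (\<lambda>p. cis (fst p \<bullet> snd p) * (h (fst p) * \<psi> (snd p)))"
    by (intro integrable_cis_mult lborel_pair.integrable_product_mult h \<psi>) measurable
  then have "(LINT x|lborel. LINT \<xi>|lborel. cis (\<xi> \<bullet> x) * (h \<xi> * \<psi> x))
      = (LINT \<xi>|lborel. LINT x|lborel. cis (\<xi> \<bullet> x) * (h \<xi> * \<psi> x))"
    by (intro lborel_pair.Fubini_integral) (simp add: case_prod_beta')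
  then have swap: "(LINT \<xi>|lborel. h \<xi> * (LINT x|lborel. cis (\<xi> \<bullet> x) * \<psi> x))
      = (LINT x|lborel. (LINT \<xi>|lborel. cis (x \<bullet> \<xi>) * h \<xi>) * \<psi> x)"
    by (simp add: mult_ac inner_commute flip: integral_mult_right_zero integral_mult_left_zero)
  show ?thesis
    unfolding inv_fourier_def mult.left_commute[of "h _"] mult.assoc integral_mult_right_zero swap ..
qed

text \<open>The squared modulus of the transform of \<open>h\<close> is the transform of the correlation of \<open>h\<close>, written as
  one integral over the product space so that Fubini's theorem applies to it.\<close>

lemma norm_square_inv_fourier:
  fixes h :: "'a::euclidean_space \<Rightarrow> complex"
  assumes h: "integrable lborel h"
  shows "complex_of_real ((norm (inv_fourier h x))\<^sup>2)
    = of_real ((2 * pi) powr - real DIM('a))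
      * (LINT q|lborel. cis ((fst q - snd q) \<bullet> x) * (h (fst q) * cnj (h (snd q))))"
proof -
  let ?F = "\<lambda>\<xi>. cis (x \<bullet> \<xi>) * h \<xi>"
  let ?G = "\<lambda>\<xi>. cnj (?F \<xi>)"
  have F: "integrable lborel ?F" by (intro integrable_cis_mult h) auto
  then have G: "integrable lborel ?G" by (rule integrable_cnj)
  have "(LINT q|lborel. ?F (fst q) * ?G (snd q)) = (LINT \<xi>|lborel. LINT \<eta>|lborel. ?F \<xi> * ?G \<eta>)"
    using lborel_pair.integral_fst'[OF lborel_pair.integrable_product_mult[OF F G]]
    by (simp add: lborel_prod)
  also have "\<dots> = integral\<^sup>L lborel ?F * integral\<^sup>L lborel ?G"
    by (simp only: integral_mult_right_zero integral_mult_left_zero)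
  also have "integral\<^sup>L lborel ?G = cnj (integral\<^sup>L lborel ?F)"
    by (rule Bochner_Integration.integral_cnj)
  finally have eq: "(LINT q|lborel. ?F (fst q) * ?G (snd q))
      = integral\<^sup>L lborel ?F * cnj (integral\<^sup>L lborel ?F)" .
  have pw: "(2 * pi) powr (- real DIM('a) / 2) * (2 * pi) powr (- real DIM('a) / 2)
      = (2 * pi) powr - real DIM('a)"
    by (simp flip: powr_add)
  have pt: "?F (fst q) * ?G (snd q) = cis ((fst q - snd q) \<bullet> x) * (h (fst q) * cnj (h (snd q)))"
    for q
    by (simp add: inner_diff_left inner_commute[of x] cis_cnj flip: cis_mult cis_divide)
      (simp add: field_simps cis_cnj cis_inverse[symmetric])
  have "(LINT q|lborel. cis ((fst q - snd q) \<bullet> x) * (h (fst q) * cnj (h (snd q))))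
      = integral\<^sup>L lborel ?F * cnj (integral\<^sup>L lborel ?F)"
    using eq unfolding pt .
  then show ?thesis
    unfolding complex_norm_square inv_fourier_def pw[symmetric] by (simp only: of_real_mult
        complex_cnj_mult complex_cnj_complex_of_real mult_ac)
qed

text \<open>Plancherel's inequality with a Gaussian factor, which makes all integrals absolutely convergent.
  Integrating the Gaussian first turns the left-hand side into the double integral of
  \<open>h \<xi> * cnj (h \<eta>)\<close> against the Gaussian kernel at \<open>\<xi> - \<eta>\<close>. The kernel is nonnegative with integral 1
  in each variable, so bounding the product by the mean of the two squares gives the claim.\<close>

lemma nn_integral_inv_fourier_gaussian_le:
  fixes h :: "'a::euclidean_space \<Rightarrow> complex"
  assumes h: "integrable lborel h" and \<sigma>: "\<sigma> > 0"
  shows "(\<integral>\<^sup>+x. ennreal ((norm (inv_fourier h x))\<^sup>2 * exp (- (\<sigma> * norm x)\<^sup>2 / 2)) \<partial>lborel)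
    \<le> (\<integral>\<^sup>+\<xi>. ennreal ((norm (h \<xi>))\<^sup>2) \<partial>lborel)"
proof -
  have [measurable]: "h \<in> borel_measurable borel" using h by auto
  define \<gamma> where "\<gamma> = (\<lambda>x::'a. exp (- (\<sigma> * norm x)\<^sup>2 / 2))"
  define w where "w = (\<lambda>q. h (fst q) * cnj (h (snd q)))"
  define K where "K = (\<lambda>q::'a \<times> 'a. gaussian_kernel \<sigma> (fst q - snd q))"
  define c where "c = (2 * pi) powr - real DIM('a)"
  have c: "c * (2 * pi) ^ DIM('a) = 1"
    unfolding c_def by (subst powr_realpow[symmetric]) (simp_all flip: powr_add)
  have \<gamma>: "integrable lborel \<gamma>" unfolding \<gamma>_def by (rule fourier_gaussian(2)[OF \<sigma>])
  have w: "integrable lborel w"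
    using lborel_pair.integrable_product_mult[OF h integrable_cnj[OF h]]
    by (simp add: w_def lborel_prod)
  have [measurable]: "w \<in> borel_measurable (borel \<Otimes>\<^sub>M borel)" "K
      \<in> borel_measurable (borel \<Otimes>\<^sub>M borel)"
    unfolding w_def K_def by measurable
  have "integrable (lborel \<Otimes>\<^sub>M lborel) (\<lambda>p. of_real (\<gamma> (fst p)) * w (snd p))"
    using \<gamma> w by (intro lborel_pair.integrable_product_mult integrable_of_real)
  then have "integrable (lborel \<Otimes>\<^sub>M lborel) (\<lambda>p. cis ((fst (snd p) - snd (snd p)) \<bullet> fst p) * (of_real (\<gamma> (fst p)) * w (snd p)))"
  proof (rule integrable_cis_mult)
    show "(\<lambda>p::'a \<times> 'a \<times> 'a. (fst (snd p) - snd (snd p)) \<bullet> fst p)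
        \<in> borel_measurable (lborel \<Otimes>\<^sub>M lborel)"
    proof -
      have "(\<lambda>p::'a \<times> 'a \<times> 'a. (fst (snd p) - snd (snd p)) \<bullet> fst p) \<in> borel_measurable borel"
        by (intro borel_measurable_continuous_onI continuous_intros)
      then show ?thesis by (simp add: lborel_prod)
    qed
  qed
  then have int: "integrable (lborel \<Otimes>\<^sub>M lborel) (\<lambda>(x, q). of_real (\<gamma> x) * (cis ((fst q - snd q) \<bullet> x) * w q))"
    by (simp add: case_prod_beta' mult_ac)
  have inner: "(LINT q|lborel. of_real (\<gamma> x) * (cis ((fst q - snd q) \<bullet> x) * w q))
      = of_real ((2 * pi) ^ DIM('a) * ((norm (inv_fourier h x))\<^sup>2 * \<gamma> x))" for x
  proof -
    have "of_real ((2 * pi) ^ DIM('a)) * complex_of_real ((norm (inv_fourier h x))\<^sup>2)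
        = of_real (c * (2 * pi) ^ DIM('a)) * (LINT q|lborel. cis ((fst q - snd q) \<bullet> x) * w q)"
      unfolding norm_square_inv_fourier[OF h] c_def w_def by (simp only: of_real_mult mult_ac)
    then show ?thesis
      unfolding c integral_mult_right_zero by (simp only: of_real_mult of_real_1 mult_1_left mult_ac)
  qed
  have outer: "(LINT x|lborel. of_real (\<gamma> x) * (cis ((fst q - snd q) \<bullet> x) * w q))
      = of_real ((2 * pi) ^ DIM('a)) * (of_real (K q) * w q)"
    for q
  proof -
    have "(LINT x|lborel. of_real (\<gamma> x) * (cis ((fst q - snd q) \<bullet> x) * w q))
        = (LINT x|lborel. cis ((fst q - snd q) \<bullet> x) * of_real (\<gamma> x)) * w q"
      by (subst integral_mult_left_zero[symmetric]) (simp add: mult_ac)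
    then show ?thesis unfolding \<gamma>_def fourier_gaussian(1)[OF \<sigma>] by (simp add: K_def)
  qed
  have "(LINT x|lborel. LINT q|lborel. of_real (\<gamma> x) * (cis ((fst q - snd q) \<bullet> x) * w q))
      = (LINT q|lborel. LINT x|lborel. of_real (\<gamma> x) * (cis ((fst q - snd q) \<bullet> x) * w q))"
    by (rule lborel_pair.Fubini_integral[OF int, symmetric])
  also have "\<dots> = (LINT q|lborel. of_real ((2 * pi) ^ DIM('a)) * (of_real (K q) * w q))"
    unfolding outer ..
  finally have "of_real ((2 * pi) ^ DIM('a)) * (LINT x|lborel. complex_of_real ((norm (inv_fourier h x))\<^sup>2 * \<gamma> x))
      = complex_of_real ((2 * pi) ^ DIM('a)) * (LINT q|lborel. of_real (K q) * w q)"
    unfolding inner unfolding of_real_mult[of "(2 * pi) ^ DIM('a)"] integral_mult_right_zero .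
  then have eq: "complex_of_real (LINT x|lborel. (norm (inv_fourier h x))\<^sup>2 * \<gamma> x)
      = (LINT q|lborel. of_real (K q) * w q)"
    unfolding integral_complex_of_real by simp
  have "integrable lborel (\<lambda>x. complex_of_real ((2 * pi) ^ DIM('a) * ((norm (inv_fourier h x))\<^sup>2 * \<gamma> x)))"
    using lborel_pair.integrable_fst[OF int] unfolding inner .
  then have "integrable lborel (\<lambda>x. (norm (inv_fourier h x))\<^sup>2 * \<gamma> x)"
    unfolding complex_of_real_integrable_eq by simp
  then have "(\<integral>\<^sup>+x. ennreal ((norm (inv_fourier h x))\<^sup>2 * \<gamma> x) \<partial>lborel)
      = ennreal (LINT x|lborel. (norm (inv_fourier h x))\<^sup>2 * \<gamma> x)"
    by (intro nn_integral_eq_integral) (auto simp: \<gamma>_def)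
  also have "\<dots> \<le> ennreal (norm (LINT q|lborel. of_real (K q) * w q))"
    unfolding eq[symmetric] by (intro ennreal_leI) simp
  also have "\<dots> \<le> (\<integral>\<^sup>+q. ennreal (norm (of_real (K q) * w q)) \<partial>lborel)"
  proof (cases "integrable lborel (\<lambda>q. of_real (K q) * w q)")
    case True
    then show ?thesis by (rule integral_norm_bound_ennreal)
  qed (simp add: not_integrable_integral_eq)
  also have "\<dots> \<le> (\<integral>\<^sup>+q. ennreal ((norm (h (fst q)))\<^sup>2 / 2) * ennreal (K q) + ennreal ((norm (h (snd q)))\<^sup>2 / 2) * ennreal (K q) \<partial>lborel)"
  proof (rule nn_integral_mono)
    fix q
    have K: "K q \<ge> 0" by (simp add: K_def gaussian_kernel_nonneg)
    have "norm (h (fst q)) * norm (h (snd q)) \<le> (norm (h (fst q)))\<^sup>2 / 2 + (norm (h (snd q)))\<^sup>2 / 2"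
      using sum_squares_bound[of "norm (h (fst q))" "norm (h (snd q))"] by simp
    from mult_right_mono[OF this K]
    have "norm (of_real (K q) * w q)
        \<le> (norm (h (fst q)))\<^sup>2 / 2 * K q + (norm (h (snd q)))\<^sup>2 / 2 * K q"
      using K by (simp add: w_def norm_mult algebra_simps)
    then have "ennreal (norm (of_real (K q) * w q))
        \<le> ennreal ((norm (h (fst q)))\<^sup>2 / 2 * K q + (norm (h (snd q)))\<^sup>2 / 2 * K q)"
      by (rule ennreal_leI)
    also have "\<dots> = ennreal ((norm (h (fst q)))\<^sup>2 / 2) * ennreal (K q)
        + ennreal ((norm (h (snd q)))\<^sup>2 / 2) * ennreal (K q)"
      by (rule ennreal_sum_of_products[symmetric]) (use K in auto)
    finally show "ennreal (norm (of_real (K q) * w q))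
        \<le> ennreal ((norm (h (fst q)))\<^sup>2 / 2) * ennreal (K q)
        + ennreal ((norm (h (snd q)))\<^sup>2 / 2) * ennreal (K q)" .
  qed
  also have "\<dots> = (\<integral>\<^sup>+q. ennreal ((norm (h (fst q)))\<^sup>2 / 2) * ennreal (K q) \<partial>(lborel \<Otimes>\<^sub>M lborel))
      + (\<integral>\<^sup>+q. ennreal ((norm (h (snd q)))\<^sup>2 / 2) * ennreal (K q) \<partial>(lborel \<Otimes>\<^sub>M lborel))"
    unfolding lborel_prod[symmetric] by (rule nn_integral_add) measurable
  also have "(\<integral>\<^sup>+q. ennreal ((norm (h (fst q)))\<^sup>2 / 2) * ennreal (K q) \<partial>(lborel \<Otimes>\<^sub>M lborel))
      = (\<integral>\<^sup>+\<xi>. ennreal ((norm (h \<xi>))\<^sup>2 / 2) \<partial>lborel)"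
  proof -
    have K1: "(\<integral>\<^sup>+\<eta>. ennreal (K (\<xi>, \<eta>)) \<partial>lborel) = 1" for \<xi>
      using nn_integral_gaussian_kernel[OF \<sigma>, of "- \<xi>"] gaussian_kernel_minus[of \<sigma> \<xi>] by (simp add: K_def)
    show ?thesis
      by (subst lborel.nn_integral_fst[symmetric]) (auto simp: nn_integral_cmult K1)
  qed
  also have "(\<integral>\<^sup>+q. ennreal ((norm (h (snd q)))\<^sup>2 / 2) * ennreal (K q) \<partial>(lborel \<Otimes>\<^sub>M lborel))
      = (\<integral>\<^sup>+\<xi>. ennreal ((norm (h \<xi>))\<^sup>2 / 2) \<partial>lborel)"
  proof -
    have K1: "(\<integral>\<^sup>+\<xi>. ennreal (K (\<xi>, \<eta>)) \<partial>lborel) = 1" for \<eta>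
      using nn_integral_gaussian_kernel[OF \<sigma>, of "- \<eta>"] by (simp add: K_def)
    show ?thesis
      by (subst lborel_pair.nn_integral_snd[symmetric]) (auto simp: nn_integral_cmult K1 case_prod_beta')
  qed
  also have "(\<integral>\<^sup>+\<xi>. ennreal ((norm (h \<xi>))\<^sup>2 / 2) \<partial>lborel)
      + (\<integral>\<^sup>+\<xi>. ennreal ((norm (h \<xi>))\<^sup>2 / 2) \<partial>lborel)
      = (\<integral>\<^sup>+\<xi>. ennreal ((norm (h \<xi>))\<^sup>2) \<partial>lborel)"
    by (subst nn_integral_add[symmetric]) (auto simp flip: ennreal_plus)
  finally show ?thesis by (simp add: \<gamma>_def)
qed

text \<open>The Gaussian factor is removed by letting its width tend to infinity.\<close>

theorem plancherel_inequality:
  fixes h :: "'a::euclidean_space \<Rightarrow> complex"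
  assumes h: "integrable lborel h"
  shows "(\<integral>\<^sup>+x. ennreal ((norm (inv_fourier h x))\<^sup>2) \<partial>lborel)
      \<le> (\<integral>\<^sup>+\<xi>. ennreal ((norm (h \<xi>))\<^sup>2) \<partial>lborel)"
proof (rule nn_integral_norm_square_limit_le)
  have [measurable]: "h \<in> borel_measurable borel" using h by auto
  \<comment> \<open>The factor is the square root of the Gaussian, so that its square appears in the norm.\<close>
  define u where "u = (\<lambda>k x. inv_fourier h x * of_real (exp (- (inverse (real (Suc k)) * norm x)\<^sup>2 / 4)))"
  show "u k \<in> borel_measurable lborel" for k
    unfolding u_def by measurable
  have "(\<lambda>k. u k x) \<longlonglongrightarrow> inv_fourier h x * of_real (exp (- (0 * norm x)\<^sup>2 / 4))" for x
    unfolding u_def by (intro tendsto_intros LIMSEQ_inverse_real_of_nat) auto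
  then show "AE x in lborel. (\<lambda>k. u k x) \<longlonglongrightarrow> inv_fourier h x" by simp
  have sq: "(norm (u k x))\<^sup>2
      = (norm (inv_fourier h x))\<^sup>2 * exp (- (inverse (real (Suc k)) * norm x)\<^sup>2 / 2)"
    for k x
    by (simp add: u_def norm_mult power_mult_distrib flip: exp_double)
  show "\<forall>\<^sub>F k in sequentially. (\<integral>\<^sup>+x. ennreal ((norm (u k x))\<^sup>2) \<partial>lborel)
      \<le> (\<integral>\<^sup>+\<xi>. ennreal ((norm (h \<xi>))\<^sup>2) \<partial>lborel)"
    unfolding sq by (intro always_eventually allI nn_integral_inv_fourier_gaussian_le h) simp
qed

text \<open>The inverse Fourier transform of an \<open>L\<^sup>2\<close> function \<open>h\<close>, characterised by duality. The truncations of
  \<open>h\<close> to balls are integrable and converge to \<open>h\<close> in \<open>L\<^sup>2\<close>; along a fast subsequence their transforms are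
  \<open>L\<^sup>2\<close>-Cauchy by Plancherel's inequality, and the pairing identity passes to the limit on both sides.\<close>

lemma L2_inv_fourier_exists:
  fixes h :: "'a::euclidean_space \<Rightarrow> complex"
  assumes [measurable]: "h \<in> borel_measurable borel"
    and fin: "(\<integral>\<^sup>+\<xi>. ennreal ((norm (h \<xi>))\<^sup>2) \<partial>lborel) < \<infinity>"
  obtains f where "f \<in> borel_measurable borel"
    and "(\<integral>\<^sup>+x. ennreal ((norm (f x))\<^sup>2) \<partial>lborel) \<le> (\<integral>\<^sup>+\<xi>. ennreal ((norm (h \<xi>))\<^sup>2) \<partial>lborel)"
    and "\<And>\<psi>. \<lbrakk>integrable lborel \<psi>; (\<integral>\<^sup>+x. ennreal ((norm (\<psi> x))\<^sup>2) \<partial>lborel) < \<infinity>\<rbrakk>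
      \<Longrightarrow> (LINT \<xi>|lborel. h \<xi> * inv_fourier \<psi> \<xi>) = (LINT x|lborel. f x * \<psi> x)"
proof -
  let ?I = "\<lambda>f::'a \<Rightarrow> complex. \<integral>\<^sup>+x. ennreal ((norm (f x))\<^sup>2) \<partial>lborel"
  define a where "a = (\<lambda>N::nat. \<lambda>\<xi>. if norm \<xi> \<le> real N then h \<xi> else 0)"
  have [measurable]: "a N \<in> borel_measurable borel" for N
    unfolding a_def by measurable
  have "(\<lambda>N. ?I (\<lambda>\<xi>. h \<xi> - a N \<xi>)) \<longlonglongrightarrow> (\<integral>\<^sup>+x. 0 \<partial>(lborel :: 'a measure))"
  proof (rule nn_integral_dominated_convergence)
    show "AE \<xi> in lborel. ennreal ((norm (h \<xi> - a N \<xi>))\<^sup>2) \<le> ennreal ((norm (h \<xi>))\<^sup>2)" for N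
      by (auto simp: a_def indicator_def)
    have "(\<lambda>N. ennreal ((norm (h \<xi> - a N \<xi>))\<^sup>2)) \<longlonglongrightarrow> 0" for \<xi>
    proof (rule tendsto_eventually)
      obtain N0 :: nat where "norm \<xi> \<le> real N0" using real_arch_simple by blast
      then show "\<forall>\<^sub>F N in sequentially. ennreal ((norm (h \<xi> - a N \<xi>))\<^sup>2) = 0"
        unfolding eventually_sequentially by (auto simp: a_def intro!: exI[of _ N0])
    qed
    then show "AE \<xi> in lborel. (\<lambda>N. ennreal ((norm (h \<xi> - a N \<xi>))\<^sup>2)) \<longlonglongrightarrow> 0" by simp
  qed (use fin in auto)
  then have "\<exists>N. ?I (\<lambda>\<xi>. h \<xi> - a N \<xi>) < ennreal ((1 / 4) ^ k)" for k
    by (intro eventually_happens'[OF _ order_tendstoD(2)]) auto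
  then obtain r where r: "\<And>k. ?I (\<lambda>\<xi>. h \<xi> - a (r k) \<xi>) < ennreal ((1 / 4) ^ k)" by metis
  have aI: "integrable lborel (a N)" for N
  proof (rule integrableI_bounded)
    have "(\<integral>\<^sup>+\<xi>. ennreal (norm (a N \<xi>)) \<partial>lborel)
        \<le> (\<integral>\<^sup>+\<xi>. ennreal ((norm (h \<xi>))\<^sup>2) + indicator (cball 0 (real N)) \<xi> \<partial>lborel)"
    proof (rule nn_integral_mono)
      fix \<xi> :: 'a
      have "norm (h \<xi>) \<le> (norm (h \<xi>))\<^sup>2 + 1"
        using sum_squares_bound[of "norm (h \<xi>)" 1] norm_ge_zero[of "h \<xi>"]
        unfolding power_one mult_1_right by linarith
      then show "ennreal (norm (a N \<xi>)) \<le> ennreal ((norm (h \<xi>))\<^sup>2) + indicator (cball 0 (real N)) \<xi>"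
        by (auto simp: a_def indicator_def simp flip: ennreal_1 ennreal_plus intro: ennreal_leI)
    qed
    also have "\<dots> = ?I h + emeasure lborel (cball (0::'a) (real N))"
      by (subst nn_integral_add) (auto intro!: borel_measurable_indicator)
    also have "\<dots> < \<infinity>" using fin emeasure_lborel_cball_finite[of "0::'a" "real N"] by simp
    finally show "(\<integral>\<^sup>+\<xi>. ennreal (norm (a N \<xi>)) \<partial>lborel) < \<infinity>" .
  qed auto
  have a_le: "?I (a N) \<le> ?I h" for N
    by (intro nn_integral_mono ennreal_leI) (auto simp: a_def indicator_def)
  have a_diff_le: "?I (\<lambda>\<xi>. a (r j) \<xi> - a (r k) \<xi>) \<le> ennreal ((1 / 4) ^ k)" if "k \<le> j" for j k
  proof -
    \<comment> \<open>The subsequence \<open>r\<close> need not be monotone, so the smaller of the two balls decides.\<close>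
    define m where "m = (if r k \<le> r j then k else j)"
    have "?I (\<lambda>\<xi>. a (r j) \<xi> - a (r k) \<xi>) \<le> ?I (\<lambda>\<xi>. h \<xi> - a (r m) \<xi>)"
      by (intro nn_integral_mono ennreal_leI) (auto simp: a_def indicator_def m_def)
    also have "\<dots> \<le> ennreal ((1 / 4) ^ m)" using r by (rule less_imp_le)
    also have "\<dots> \<le> ennreal ((1 / 4) ^ k)"
      using that by (intro ennreal_leI power_decreasing) (auto simp: m_def)
    finally show ?thesis .
  qed
  define s where "s = (\<lambda>k. inv_fourier (a (r k)))"
  have [measurable]: "s k \<in> borel_measurable borel" for k unfolding s_def by measurable
  have s_diff_le: "?I (\<lambda>x. s j x - s k x) \<le> ennreal ((1 / 4) ^ k)" if "k \<le> j" for j k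
    using order.trans[OF plancherel_inequality[OF Bochner_Integration.integrable_diff[OF aI[of "r j"] aI[of "r k"]]]
      a_diff_le[OF that]]
    by (simp add: s_def inv_fourier_diff[OF aI aI])
  have s_le: "?I (s k) \<le> ?I h" for k
    using order.trans[OF plancherel_inequality[OF aI] a_le] by (simp add: s_def)
  define f where "f = (\<lambda>x. lim (\<lambda>k. s k x))"
  have [measurable]: "f \<in> borel_measurable borel" unfolding f_def by measurable
  have "AE x in lborel. convergent (\<lambda>k. s k x)"
    by (rule AE_convergent_fast_L2_Cauchy) (use s_diff_le in auto)
  then have lim: "AE x in lborel. (\<lambda>k. s k x) \<longlonglongrightarrow> f x"
    by eventually_elim (simp add: f_def convergent_LIMSEQ_iff)
  have f_le: "?I f \<le> ?I h"
    by (rule nn_integral_norm_square_limit_le[where u = s])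
      (use lim s_le in \<open>auto intro: always_eventually\<close>)
  have f_close: "?I (\<lambda>x. f x - s k x) \<le> ennreal ((1 / 4) ^ k)" for k
  proof (rule nn_integral_norm_square_limit_le[where u = "\<lambda>j x. s j x - s k x"])
    show "AE x in lborel. (\<lambda>j. s j x - s k x) \<longlonglongrightarrow> f x - s k x"
      using lim by eventually_elim (intro tendsto_intros)
    show "\<forall>\<^sub>F j in sequentially. ?I (\<lambda>x. s j x - s k x) \<le> ennreal ((1 / 4) ^ k)"
      using eventually_ge_at_top[of k] by eventually_elim (rule s_diff_le)
  qed measurable
  show thesis
  proof (rule that[OF _ f_le])
    fix \<psi> :: "'a \<Rightarrow> complex"
    assume \<psi>: "integrable lborel \<psi>" "?I \<psi> < \<infinity>"
    then have [measurable]: "\<psi> \<in> borel_measurable borel" by auto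
    have "?I (inv_fourier \<psi>) < \<infinity>"
      using plancherel_inequality[OF \<psi>(1)] \<psi>(2) by (rule le_less_trans)
    then have "(\<lambda>k. LINT \<xi>|lborel. a (r k) \<xi> * inv_fourier \<psi> \<xi>)
        \<longlonglongrightarrow> (LINT \<xi>|lborel. h \<xi> * inv_fourier \<psi> \<xi>)"
      by (intro L2_pairing_tendsto) (use fin le_less_trans[OF a_le fin] r in \<open>auto intro: less_imp_le\<close>)
    moreover have "(\<lambda>k. LINT x|lborel. s k x * \<psi> x) \<longlonglongrightarrow> (LINT x|lborel. f x * \<psi> x)"
      by (intro L2_pairing_tendsto \<psi>(2) f_close)
        (use le_less_trans[OF f_le fin] le_less_trans[OF s_le fin] in auto)
    ultimately show "(LINT \<xi>|lborel. h \<xi> * inv_fourier \<psi> \<xi>) = (LINT x|lborel. f x * \<psi> x)"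
      unfolding s_def inv_fourier_pairing[OF aI \<psi>(1)] by (rule LIMSEQ_unique)
  qed measurable
qed

section \<open>Schwartz functions are integrable\<close>

lemma nn_integral_inverse_one_plus_square:
  "(\<integral>\<^sup>+x. ennreal (inverse (1 + x\<^sup>2)) \<partial>(lborel :: real measure)) < \<infinity>"
proof -
  have "integrable lborel (\<lambda>x::real. inverse (1 + x\<^sup>2))"
    using integrable_inverse_1_plus_square by (simp add: set_integrable_def)
  then show ?thesis by (simp add: integrable_iff_bounded abs_of_nonneg)
qed

lemma integrable_inverse_power_norm:
  "integrable lborel (\<lambda>x::'a::euclidean_space. inverse ((1 + norm x) ^ (2 * DIM('a))))"
proof (rule integrableI_bounded)
  \<comment> \<open>Comparison with a product of one-dimensional integrable functions.\<close>
  have "inverse ((1 + norm x) ^ (2 * DIM('a))) \<le> (\<Prod>i\<in>Basis. inverse (1 + (x \<bullet> i)\<^sup>2))" for x :: 'a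
  proof -
    have "(\<Prod>i\<in>Basis. 1 + (x \<bullet> i)\<^sup>2) \<le> (\<Prod>i\<in>(Basis::'a set). (1 + norm x)\<^sup>2)"
    proof (rule prod_mono)
      fix i :: 'a assume "i \<in> Basis"
      then have "(x \<bullet> i)\<^sup>2 \<le> (norm x)\<^sup>2"
        using Basis_le_norm[of i x] by (simp add: abs_le_square_iff[symmetric])
      then show "0 \<le> 1 + (x \<bullet> i)\<^sup>2 \<and> 1 + (x \<bullet> i)\<^sup>2 \<le> (1 + norm x)\<^sup>2"
        using add_mono[of "(x \<bullet> i)\<^sup>2" "(norm x)\<^sup>2" 0 "2 * norm x"] by (simp add: power2_sum)
    qed
    then have "(\<Prod>i\<in>Basis. 1 + (x \<bullet> i)\<^sup>2) \<le> (1 + norm x) ^ (2 * DIM('a))"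
      by (simp add: power_mult)
    moreover have "0 < (\<Prod>i\<in>Basis. 1 + (x \<bullet> i)\<^sup>2)"
      by (intro prod_pos) (auto intro: add_pos_nonneg)
    ultimately have "inverse ((1 + norm x) ^ (2 * DIM('a))) \<le> inverse (\<Prod>i\<in>Basis. 1 + (x \<bullet> i)\<^sup>2)"
      by (rule le_imp_inverse_le)
    then show ?thesis using prod_inversef[of "\<lambda>i. 1 + (x \<bullet> i)\<^sup>2" Basis] by (simp add: o_def)
  qed
  then have "(\<integral>\<^sup>+x. ennreal (norm (inverse ((1 + norm x) ^ (2 * DIM('a))))) \<partial>(lborel :: 'a measure))
      \<le> (\<integral>\<^sup>+x. (\<Prod>i\<in>Basis. ennreal (inverse (1 + (x \<bullet> i)\<^sup>2))) \<partial>(lborel :: 'a measure))"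
    by (intro nn_integral_mono) (auto simp: prod_ennreal abs_of_nonneg intro!: ennreal_leI)
  also have "\<dots> = (\<Prod>i\<in>(Basis::'a set). \<integral>\<^sup>+x. ennreal (inverse (1 + x\<^sup>2)) \<partial>lborel)"
    by (rule nn_integral_lborel_prod) auto
  also have "\<dots> < \<infinity>"
    using nn_integral_inverse_one_plus_square by (simp add: power_less_top_ennreal)
  finally show "(\<integral>\<^sup>+x. ennreal (norm (inverse ((1 + norm x) ^ (2 * DIM('a))))) \<partial>(lborel :: 'a measure)) < \<infinity>" .
qed measurable

lemma schwartz_integrable:
  fixes \<psi> :: "'a::euclidean_space \<Rightarrow> complex"
  assumes "\<psi> \<in> schwartz"
  shows "integrable lborel \<psi>" and "(\<integral>\<^sup>+x. ennreal ((norm (\<psi> x))\<^sup>2) \<partial>lborel) < \<infinity>"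
proof -
  have "\<forall>x. iter_deriv [] \<psi> differentiable at x"
    and decay: "\<forall>k::nat. bounded (range (\<lambda>x. (1 + norm x) ^ k *\<^sub>R iter_deriv [] \<psi> x))"
    using assms unfolding schwartz_def by blast+
  then have "continuous_on UNIV \<psi>"
    by (auto intro!: continuous_at_imp_continuous_on differentiable_imp_continuous_within)
  then have [measurable]: "\<psi> \<in> borel_measurable borel"
    by (rule borel_measurable_continuous_onI)
  obtain B where B: "\<And>x. norm (\<psi> x) \<le> B"
    using decay[rule_format, of 0] by (auto simp: bounded_iff)
  obtain C where C: "\<And>x. norm ((1 + norm x) ^ (2 * DIM('a)) *\<^sub>R \<psi> x) \<le> C"
    using decay[rule_format, of "2 * DIM('a)"] by (auto simp: bounded_iff)
  have le: "norm (\<psi> x) \<le> norm (C * inverse ((1 + norm x) ^ (2 * DIM('a))))" for x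
  proof -
    have "0 < (1 + norm x) ^ (2 * DIM('a))" by (simp add: add_pos_nonneg)
    moreover have "0 \<le> C" using C[of x] norm_ge_zero by (rule order.trans[rotated])
    ultimately show ?thesis using C[of x] by (simp add: field_simps)
  qed
  show int: "integrable lborel \<psi>"
    by (rule Bochner_Integration.integrable_bound[OF integrable_mult_right[OF integrable_inverse_power_norm, of C]])
      (use le in auto)
  have "(\<integral>\<^sup>+x. ennreal ((norm (\<psi> x))\<^sup>2) \<partial>lborel) \<le> (\<integral>\<^sup>+x. ennreal B * ennreal (norm (\<psi> x)) \<partial>lborel)"
    using B order.trans[OF norm_ge_zero B]
    by (intro nn_integral_mono)
      (auto simp: power2_eq_square intro!: ennreal_leI mult_right_mono simp flip: ennreal_mult)
  also have "\<dots> = ennreal B * (\<integral>\<^sup>+x. ennreal (norm (\<psi> x)) \<partial>lborel)"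
    by (rule nn_integral_cmult) measurable
  also have "\<dots> < \<infinity>"
    using int by (simp add: integrable_iff_bounded ennreal_mult_less_top)
  finally show "(\<integral>\<^sup>+x. ennreal ((norm (\<psi> x))\<^sup>2) \<partial>lborel) < \<infinity>" .
qed

section \<open>Norms of distributions\<close>

lemma hat_measurable:
  assumes "has_fourier_transform T h"
  shows "hat T \<in> borel_measurable borel"
proof -
  have "has_fourier_transform T (hat T)"
    unfolding hat_def by (rule someI[of "has_fourier_transform T", OF assms])
  then show ?thesis by (simp add: has_fourier_transform_def)
qed

lemma L2_norm_power2: "(L2_norm f)\<^sup>2 = (\<integral>\<^sup>+x. ennreal ((norm (f x))\<^sup>2) \<partial>lborel)"
  by (cases "\<integral>\<^sup>+x. ennreal ((norm (f x))\<^sup>2) \<partial>lborel" rule: ennreal_cases)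
    (auto simp: L2_norm_def Let_def ennreal_power)

lemma ennreal_power2_le_iff: "(x::ennreal)\<^sup>2 \<le> y\<^sup>2 \<longleftrightarrow> x \<le> y"
  by (cases x; cases y)
    (auto simp: ennreal_power power_eq_top_ennreal top_unique abs_le_square_iff[symmetric])

lemma L2_norm_le_iff:
  "L2_norm f
      \<le> L2_norm g
      \<longleftrightarrow> (\<integral>\<^sup>+x. ennreal ((norm (f x))\<^sup>2) \<partial>lborel) \<le> (\<integral>\<^sup>+x. ennreal ((norm (g x))\<^sup>2) \<partial>lborel)"
  by (simp add: ennreal_power2_le_iff flip: L2_norm_power2)

text \<open>The form in which Plancherel's inequality is used: norms in physical space are controlled on the
  Fourier side. If the right-hand side is infinite there is nothing to show.\<close>

lemma L2_norm_dist_inv_fourier_le: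
  assumes [measurable]: "h \<in> borel_measurable borel"
  shows "L2_norm_dist (inv_fourier_dist h) \<le> L2_norm h"
proof (cases "L2_norm h < \<infinity>")
  case True
  then have "(\<integral>\<^sup>+x. ennreal ((norm (h x))\<^sup>2) \<partial>lborel) < \<infinity>"
    by (auto simp: L2_norm_def Let_def less_top split: if_splits)
  then obtain f where f: "f \<in> borel_measurable borel"
    "(\<integral>\<^sup>+x. ennreal ((norm (f x))\<^sup>2) \<partial>lborel) \<le> (\<integral>\<^sup>+\<xi>. ennreal ((norm (h \<xi>))\<^sup>2) \<partial>lborel)"
    "\<And>\<psi>. \<lbrakk>integrable lborel \<psi>; (\<integral>\<^sup>+x. ennreal ((norm (\<psi> x))\<^sup>2) \<partial>lborel) < \<infinity>\<rbrakk>
      \<Longrightarrow> (LINT \<xi>|lborel. h \<xi> * inv_fourier \<psi> \<xi>) = (LINT x|lborel. f x * \<psi> x)"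
    using L2_inv_fourier_exists[OF assms] by blast
  have le: "L2_norm f \<le> L2_norm h" using f(2) by (simp add: L2_norm_le_iff)
  have "(LINT \<xi>|lborel. h \<xi> * inv_fourier \<psi> \<xi>) = (LINT x|lborel. f x * \<psi> x)" if "\<psi> \<in> schwartz" for \<psi>
    by (rule f(3)[OF schwartz_integrable[OF that]])
  note pairing = this
  have "L2_norm_dist (inv_fourier_dist h) \<le> L2_norm f"
    unfolding L2_norm_dist_def
    by (rule INF_lower)
      (use f(1) pairing le_less_trans[OF le True] in \<open>auto simp: inv_fourier_dist_def\<close>)
  with le show ?thesis by (rule order.trans[rotated])
qed (auto simp: not_less top_unique)

lemma L2_norm_fourier_multiplier_le:
  assumes "has_fourier_transform T h" and [measurable]: "m \<in> borel_measurable borel"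
  shows "L2_norm_dist (fourier_multiplier m T) \<le> L2_norm (symbol_mult m (hat T))"
proof -
  have [measurable]: "hat T \<in> borel_measurable borel" by (rule hat_measurable[OF assms(1)])
  show ?thesis
    unfolding fourier_multiplier_def
    by (rule L2_norm_dist_inv_fourier_le) (simp add: symbol_mult_def)
qed

text \<open>A triangle inequality with a constant, which suffices for estimates up to constants and needs only
  \<open>(p + q)\<^sup>2 \<le> 4 (p\<^sup>2 + q\<^sup>2)\<close>.\<close>

lemma L2_norm_le_sum:
  assumes [measurable]: "F \<in> borel_measurable borel" "G \<in> borel_measurable borel" and c: "c \<ge> 0"
    and le: "AE x in lborel. norm (f x) \<le> c * (norm (F x) + norm (G x))"
  shows "L2_norm f \<le> ennreal (2 * c) * (L2_norm F + L2_norm G)"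
proof -
  have "(L2_norm f)\<^sup>2
      \<le> (\<integral>\<^sup>+x. ennreal ((2 * c)\<^sup>2) * (ennreal ((norm (F x))\<^sup>2) + ennreal ((norm (G x))\<^sup>2)) \<partial>lborel)"
    unfolding L2_norm_power2
  proof (rule nn_integral_mono_AE, use le in eventually_elim)
    fix x assume "norm (f x) \<le> c * (norm (F x) + norm (G x))"
    then have "(norm (f x))\<^sup>2 \<le> (c * (norm (F x) + norm (G x)))\<^sup>2"
      by (rule power_mono) simp
    also have "\<dots> \<le> (2 * c)\<^sup>2 * ((norm (F x))\<^sup>2 + (norm (G x))\<^sup>2)"
    proof -
      have "(p + q)\<^sup>2 \<le> 4 * (p\<^sup>2 + q\<^sup>2)" for p q :: real
      proof -
        have "0 \<le> (p - q)\<^sup>2 + 2 * p\<^sup>2 + 2 * q\<^sup>2" by simp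
        then show ?thesis by (simp add: power2_eq_square algebra_simps)
      qed
      from mult_left_mono[OF this[of "norm (F x)" "norm (G x)"] zero_le_power2[of c]]
      have "(c * (norm (F x) + norm (G x)))\<^sup>2 \<le> c\<^sup>2 * (4 * ((norm (F x))\<^sup>2 + (norm (G x))\<^sup>2))"
        unfolding power_mult_distrib .
      also have "\<dots> = (2 * c)\<^sup>2 * ((norm (F x))\<^sup>2 + (norm (G x))\<^sup>2)"
        by (simp add: power_mult_distrib)
      finally show ?thesis .
    qed
    finally show "ennreal ((norm (f x))\<^sup>2)
        \<le> ennreal ((2 * c)\<^sup>2) * (ennreal ((norm (F x))\<^sup>2) + ennreal ((norm (G x))\<^sup>2))"
      by (simp add: ennreal_leI flip: ennreal_plus ennreal_mult)
  qed
  also have "\<dots> = ennreal ((2 * c)\<^sup>2) * ((L2_norm F)\<^sup>2 + (L2_norm G)\<^sup>2)"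
    by (simp add: nn_integral_cmult nn_integral_add L2_norm_power2)
  also have "\<dots> \<le> ennreal ((2 * c)\<^sup>2) * (L2_norm F + L2_norm G)\<^sup>2"
    by (intro mult_left_mono) (auto simp: power2_eq_square distrib_left distrib_right add.assoc
        intro!: add_mono order_trans[OF _ add_increasing])
  also have "\<dots> = (ennreal (2 * c) * (L2_norm F + L2_norm G))\<^sup>2"
    using c by (simp add: power_mult_distrib ennreal_power)
  finally show ?thesis by (simp add: ennreal_power2_le_iff)
qed

lemma borel_measurable_D_symbol [measurable]: "D_symbol a \<in> borel_measurable borel"
  unfolding D_symbol_def[abs_def] by measurable

lemma borel_measurable_J_symbol [measurable]: "J_symbol a \<in> borel_measurable borel"
  unfolding J_symbol_def[abs_def] by measurable

lemma borel_measurable_symbol_mult [measurable]: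
  "\<lbrakk>m
      \<in> borel_measurable borel; h
      \<in> borel_measurable borel\<rbrakk> \<Longrightarrow> symbol_mult m h \<in> borel_measurable borel"
  unfolding symbol_mult_def[abs_def] by measurable

lemma D_symbol_add_2: "D_symbol (a + 2) \<xi> = (norm \<xi>)\<^sup>2 * D_symbol a \<xi>"
  by (cases "\<xi> = 0") (auto simp: D_symbol_def powr_add powr_numeral)

lemma D_symbol_nonneg: "D_symbol a \<xi> \<ge> 0"
  by (simp add: D_symbol_def)

lemma J_symbol_minus_2: "J_symbol (- 2) \<xi> = 1 / (1 + (norm \<xi>)\<^sup>2)"
  by (simp add: J_symbol_def powr_minus add_pos_nonneg field_simps)

section \<open>Uniform estimates for the Cauchy problem\<close>

text \<open>The bounds for a single frequency, transferred to the Fourier transforms of a solution; time is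
  replaced by the multiple \<open>L * g t\<close> that bounds it.\<close>

lemma sobolev_solution_mode_bounds:
  fixes u0 :: "'a::euclidean_space distribution"
  assumes g: "\<And>s. s \<ge> 0 \<Longrightarrow> (g has_real_derivative g' s) (at s within {0..})"
    and g_pos: "\<And>s. s \<ge> 0 \<Longrightarrow> g s > 0 \<and> g' s > 0"
    and b: "continuous_on {0..} b" and b_pos: "\<And>s. s \<ge> 0 \<Longrightarrow> b s > 0"
    and T: "T > 0" "\<And>s. s \<ge> T \<Longrightarrow> s * b s \<ge> 2"
    and L: "\<And>s. s \<ge> 0 \<Longrightarrow> integral {0..s} (\<lambda>x. 1 / g x) \<le> L"
    and sol: "sobolev_solution b g u0 u1 u ut" and t: "t \<ge> 0"
  defines "M \<equiv> \<lambda>\<xi>. (1 + 2 * T + 1 / g 0) * exp L * (norm (hat u0 \<xi>) + norm (hat u1 \<xi>) / (1 + (norm \<xi>)\<^sup>2))"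
  shows "AE \<xi> in lborel. norm (hat (u t) \<xi>) \<le> M \<xi> \<and>
    norm (hat (ut t) \<xi>) \<le> norm (hat u1 \<xi>) + (norm \<xi>)\<^sup>2 * M \<xi> * (L * g t)"
proof -
  obtain U V where UV: "AE \<xi> in lborel. U t \<xi> = hat (u t) \<xi> \<and> V t \<xi> = hat (ut t) \<xi>"
    and ode: "AE \<xi> in lborel. U 0 \<xi> = hat u0 \<xi> \<and> V 0 \<xi> = hat u1 \<xi> \<and>
          (\<forall>t\<ge>0.
            ((\<lambda>s. U s \<xi>) has_vector_derivative V t \<xi>) (at t within {0..}) \<and>
            ((\<lambda>s. V s \<xi>) has_vector_derivative
               - (of_real ((norm \<xi>)\<^sup>2) * U t \<xi>
                  + of_real (b t + g t * (norm \<xi>)\<^sup>2) * V t \<xi>)) (at t within {0..}))"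
    using sol t unfolding sobolev_solution_def by blast
  \<comment> \<open>As \<open>1 / g\<close> is decreasing, \<open>t / g t\<close> is at most its integral over \<open>{0..t}\<close>.\<close>
  have "t \<le> L * g t"
  proof -
    have g_mono: "g s \<le> g t" if "0 \<le> s" "s \<le> t" for s
      by (rule half_line_mono[OF g]) (use that g_pos in \<open>auto intro: less_imp_le\<close>)
    have "continuous_on {0..} g"
      by (rule DERIV_continuous_on) (use g in force)
    then have "continuous_on {0..t} g" by (rule continuous_on_subset) auto
    moreover have "\<forall>x\<in>{0..t}. g x \<noteq> 0"
      by (metis atLeastAtMost_iff g_pos less_irrefl)
    ultimately have "(\<lambda>x. 1 / g x) integrable_on {0..t}"
      by (intro integrable_continuous_real continuous_intros)
    then have "integral {0..t} (\<lambda>x. 1 / g t) \<le> integral {0..t} (\<lambda>x. 1 / g x)"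
      by (intro integral_le) (use g_mono g_pos in \<open>auto intro!: divide_left_mono mult_pos_pos\<close>)
    also have "\<dots> \<le> L" by (rule L[OF t])
    finally show ?thesis using t g_pos[OF t] by (simp add: field_simps)
  qed
  moreover have M: "M \<xi> \<ge> 0" for \<xi>
    unfolding M_def using T g_pos[of 0] by (intro mult_nonneg_nonneg add_nonneg_nonneg) auto
  ultimately have r2M: "(norm \<xi>)\<^sup>2 * M \<xi> * t \<le> (norm \<xi>)\<^sup>2 * M \<xi> * (L * g t)" for \<xi>
    by (intro mult_left_mono) auto
  from UV ode show ?thesis
  proof eventually_elim
    case (elim \<xi>)
    let ?N = "(norm (U 0 \<xi>) + (2 * T + 1 / g 0) * (norm (V 0 \<xi>) / (1 + (norm \<xi>)\<^sup>2))) * exp L"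
    have "norm (U 0 \<xi>) + (2 * T + 1 / g 0) * (norm (V 0 \<xi>) / (1 + (norm \<xi>)\<^sup>2))
        \<le> (1 + 2 * T + 1 / g 0) * norm (U 0 \<xi>)
        + (1 + 2 * T + 1 / g 0) * (norm (V 0 \<xi>) / (1 + (norm \<xi>)\<^sup>2))"
    proof (rule add_mono)
      show "norm (U 0 \<xi>) \<le> (1 + 2 * T + 1 / g 0) * norm (U 0 \<xi>)"
        using T g_pos[of 0] by (simp add: distrib_right)
      show "(2 * T + 1 / g 0) * (norm (V 0 \<xi>) / (1 + (norm \<xi>)\<^sup>2))
          \<le> (1 + 2 * T + 1 / g 0) * (norm (V 0 \<xi>) / (1 + (norm \<xi>)\<^sup>2))"
        by (intro mult_right_mono divide_nonneg_nonneg) auto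
    qed
    from mult_right_mono[OF this, of "exp L"]
    have "?N \<le> ((1 + 2 * T + 1 / g 0) * norm (U 0 \<xi>)
        + (1 + 2 * T + 1 / g 0) * (norm (V 0 \<xi>) / (1 + (norm \<xi>)\<^sup>2))) * exp L" by simp
    also have "\<dots> = M \<xi>"
    proof -
      have "(k * p + k * q) * e = k * e * (p + q)" for k e p q :: real by (simp add: algebra_simps)
      then show ?thesis unfolding M_def using elim by presburger
    qed
    finally have N_le: "?N \<le> M \<xi>" .
    have "norm (U t \<xi>) \<le> ?N" "norm (V t \<xi>) \<le> norm (V 0 \<xi>) + (norm \<xi>)\<^sup>2 * ?N * t"
      using mode_bounds[where U = "\<lambda>s. U s \<xi>" and V = "\<lambda>s. V s \<xi>" and r = "norm \<xi>",
          OF g g_pos b b_pos T L _ _ t] elim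
      by auto
    moreover have "(norm \<xi>)\<^sup>2 * ?N * t \<le> (norm \<xi>)\<^sup>2 * M \<xi> * t"
      using N_le t by (intro mult_right_mono mult_left_mono) auto
    ultimately show ?case using N_le r2M[of \<xi>] elim by simp
  qed
qed

text \<open>After the bounds at almost every frequency, what remains is to distribute the initial velocity
  \<open>\<bar>hat u1\<bar> = (1 + \<bar>\<xi>\<bar>\<^sup>2) X\<close>, where \<open>X\<close> is the modulus of the transform of \<open>\<langle>D\<rangle>\<^sup>-\<^sup>2 u1\<close>. If \<open>b\<close> increases, the
  two parts of \<open>1 + \<bar>\<xi>\<bar>\<^sup>2\<close> are absorbed by \<open>b t / b 0\<close> and \<open>g t / g 0\<close>; if \<open>b\<close> decreases, the whole
  of it is absorbed by \<open>g t / g 0\<close>.\<close>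

theorem theorem4p1:
  fixes b b' b'' g g' g'' :: "real \<Rightarrow> real"
    and C1 C2 a :: real
  assumes g_deriv: "\<And>t. t \<ge> 0 \<Longrightarrow> (g has_real_derivative g' t) (at t within {0..})"
    and g_deriv2: "\<And>t. t \<ge> 0 \<Longrightarrow> (g' has_real_derivative g'' t) (at t within {0..})"
    and A1: "\<And>t. t \<ge> 0 \<Longrightarrow> g t > 0 \<and> g' t > 0"
    and A2: "set_integrable lborel {0..} (\<lambda>t. 1 / g t)"
    and A3_const: "C1 > 0" "C2 > 0"
    and A3_1: "\<And>t. t > 0 \<Longrightarrow> \<bar>g' t\<bar> \<le> C1 * g t * (g t / half_primitive g t)"
    and A3_2: "\<And>t. t > 0 \<Longrightarrow> \<bar>g'' t\<bar> \<le> C2 * g t * (g t / half_primitive g t)\<^sup>2"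
    and b_pos: "\<And>t. t \<ge> 0 \<Longrightarrow> b t > 0"
    and B1_deriv: "\<And>t. t \<ge> 0 \<Longrightarrow> (b has_real_derivative b' t) (at t within {0..})"
    and B1_deriv2: "\<And>t. t \<ge> 0 \<Longrightarrow> (b' has_real_derivative b'' t) (at t within {0..})"
    and B1_cont: "continuous_on {0..} b''"
    and B2_sign: "(\<forall>t\<ge>0. b' t \<ge> 0) \<or> (\<forall>t\<ge>0. b' t \<le> 0)"
    and B2_lim: "filterlim (\<lambda>t. t * b t) at_top at_top"
    and B3_1: "\<exists>K>0. \<forall>t\<ge>0. \<bar>b' t\<bar> / b t \<le> K * (1 / (1 + t))"
    and B3_2: "\<exists>K>0. \<forall>t\<ge>0. \<bar>b'' t\<bar> / b t \<le> K * (1 / (1 + t)\<^sup>2)"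
    and EF: "a < 1" "\<And>t. t \<ge> 0 \<Longrightarrow> \<bar>b' t\<bar> \<le> a * (b t)\<^sup>2"
  shows "\<forall>\<beta>::real. \<beta> \<ge> 0 \<longrightarrow>
    (\<exists>C>0. \<forall>(u0 :: (real ^ 'n) distribution) u1 u ut. sobolev_solution b g u0 u1 u ut \<longrightarrow>
      (\<forall>t\<ge>0. L2_norm_dist (fourier_multiplier (D_symbol \<beta>) (u t)) \<le>
        ennreal C * (hdot_norm \<beta> (hat u0) + hdot_norm \<beta> (symbol_mult (J_symbol (- 2)) (hat u1))))) \<and>
    ((\<forall>t\<ge>0. b' t \<ge> 0) \<longrightarrow>
      (\<exists>C>0. \<forall>(u0 :: (real ^ 'n) distribution) u1 u ut. sobolev_solution b g u0 u1 u ut \<longrightarrow>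
        (\<forall>t\<ge>0. L2_norm_dist (fourier_multiplier (D_symbol \<beta>) (ut t)) \<le>
          ennreal C *
            (ennreal (g t) * (hdot_norm (\<beta> + 2) (hat u0)
                              + hdot_norm (\<beta> + 2) (symbol_mult (J_symbol (- 2)) (hat u1)))
             + ennreal (b t) * (hdot_norm \<beta> (hat u0)
                                + hdot_norm \<beta> (symbol_mult (J_symbol (- 2)) (hat u1))))))) \<and>
    ((\<forall>t\<ge>0. b' t < 0) \<longrightarrow>
      (\<exists>C>0. \<forall>(u0 :: (real ^ 'n) distribution) u1 u ut. sobolev_solution b g u0 u1 u ut \<longrightarrow>
        (\<forall>t\<ge>0. L2_norm_dist (fourier_multiplier (D_symbol \<beta>) (ut t)) \<le>
          ennreal C *
            (ennreal (g t) * (hdot_norm (\<beta> + 2) (hat u0) + hdot_norm \<beta> (hat u1))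
             + ennreal (b t) * (hdot_norm \<beta> (hat u0)
                                + hdot_norm \<beta> (symbol_mult (D_symbol (- 2)) (hat u1)))))))"
proof -
  obtain T where T: "T > 0" "\<And>s. s \<ge> T \<Longrightarrow> s * b s \<ge> 2"
  proof -
    have "\<forall>\<^sub>F t in at_top. t * b t \<ge> 2"
      using B2_lim by (simp add: filterlim_at_top)
    then obtain N where "\<And>s. s \<ge> N \<Longrightarrow> s * b s \<ge> 2"
      by (auto simp: eventually_at_top_linorder)
    then show thesis by (intro that[of "max N 1"]) auto
  qed
  define L where "L = integral {0..} (\<lambda>t. 1 / g t)"
  have cont: "continuous_on {0..} g" "continuous_on {0..} b"
    by (rule DERIV_continuous_on, use g_deriv B1_deriv in force)+
  have L: "integral {0..s} (\<lambda>t. 1 / g t) \<le> L" if "s \<ge> 0" for s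
    unfolding L_def
  proof (rule integral_subset_le)
    show "(\<lambda>t. 1 / g t) integrable_on {0..}"
      using A2 by (rule set_borel_integral_eq_integral)
    have "continuous_on {0..s} (\<lambda>t. 1 / g t)"
      by (intro continuous_intros continuous_on_subset[OF cont(1)]) (use A1 in force)+
    then show "(\<lambda>t. 1 / g t) integrable_on {0..s}" by (rule integrable_continuous_real)
  qed (use A1 in \<open>auto intro: less_imp_le\<close>)
  have L_nonneg: "L \<ge> 0" using L[of 0] by simp
  define K where "K = (1 + 2 * T + 1 / g 0) * exp L"
  have K: "K > 0" unfolding K_def using T(1) A1[of 0] by (intro mult_pos_pos add_pos_pos) auto
  define X where "X = (\<lambda>u1 (\<xi>::real^'n). norm (hat u1 \<xi>) / (1 + (norm \<xi>)\<^sup>2))"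
  have X: "X u1 \<xi> \<ge> 0" "norm (hat u1 \<xi>) = X u1 \<xi> + (norm \<xi>)\<^sup>2 * X u1 \<xi>" for u1 \<xi>
  proof -
    have "1 + (norm \<xi>)\<^sup>2 > 0" by (simp add: add_pos_nonneg)
    then have "norm (hat u1 \<xi>) = (1 + (norm \<xi>)\<^sup>2) * X u1 \<xi>" by (simp add: X_def)
    then show "norm (hat u1 \<xi>) = X u1 \<xi> + (norm \<xi>)\<^sup>2 * X u1 \<xi>" by (simp add: distrib_right)
    show "X u1 \<xi> \<ge> 0" by (simp add: X_def add_nonneg_nonneg)
  qed
  have mode: "AE \<xi> in lborel. norm (hat (u t) \<xi>) \<le> K * (norm (hat u0 \<xi>) + X u1 \<xi>) \<and>
      norm (hat (ut t) \<xi>)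
      \<le> norm (hat u1 \<xi>) + L * K * (g t * ((norm \<xi>)\<^sup>2 * norm (hat u0 \<xi>) + (norm \<xi>)\<^sup>2 * X u1 \<xi>))"
    if "sobolev_solution b g u0 u1 u ut" "t \<ge> 0" for u0 u1 :: "(real ^ 'n) distribution" and u ut t
  proof -
    have X_eq: "norm (hat u1 \<xi>) / (1 + (norm \<xi>)\<^sup>2) = X u1 \<xi>" for \<xi> by (simp add: X_def)
    have reorder: "r * (K * (p + q)) * (L * g t) = L * K * (g t * (r * p + r * q))" for p q r
      by (simp add: algebra_simps)
    show ?thesis
      using sobolev_solution_mode_bounds[where g = g and b = b, OF g_deriv A1 cont(2) b_pos T L that]
      unfolding K_def[symmetric] X_eq reorder by simp
  qed
  have meas: "hat u0 \<in> borel_measurable borel" "hat u1 \<in> borel_measurable borel"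
    and multiplier: "\<And>t m. \<lbrakk>t \<ge> 0; m \<in> borel_measurable borel\<rbrakk> \<Longrightarrow>
      L2_norm_dist (fourier_multiplier m (u t)) \<le> L2_norm (symbol_mult m (hat (u t))) \<and>
      L2_norm_dist (fourier_multiplier m (ut t)) \<le> L2_norm (symbol_mult m (hat (ut t)))"
    if "sobolev_solution b g u0 u1 u ut" for u0 u1 :: "(real ^ 'n) distribution" and u ut
    using that by (auto simp: sobolev_solution_def intro: hat_measurable L2_norm_fourier_multiplier_le)
  have g_mono: "g 0 \<le> g t" if "t \<ge> 0" for t
    by (rule half_line_mono[OF g_deriv]) (use that A1 in \<open>auto intro: less_imp_le\<close>)
  have norm_D: "norm (symbol_mult (D_symbol a) h \<xi>) = D_symbol a \<xi> * norm (h \<xi>)"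
    for a h and \<xi> :: "real^'n"
    by (simp add: symbol_mult_def norm_mult D_symbol_nonneg)
  have norm_J: "norm (symbol_mult (J_symbol (- 2)) (hat u1) \<xi>) = X u1 \<xi>" for u1 and \<xi> :: "real^'n"
    by (simp only: symbol_mult_def norm_mult norm_of_real J_symbol_minus_2)
      (simp add: X_def add_nonneg_nonneg)
  show ?thesis
  proof (intro allI impI conjI)
    fix \<beta> :: real
    let ?D = "D_symbol \<beta> :: real ^ 'n \<Rightarrow> real"
    show "\<exists>C>0. \<forall>(u0 :: (real ^ 'n) distribution) u1 u ut. sobolev_solution b g u0 u1 u ut \<longrightarrow>
      (\<forall>t\<ge>0. L2_norm_dist (fourier_multiplier (D_symbol \<beta>) (u t)) \<le>
        ennreal C * (hdot_norm \<beta> (hat u0) + hdot_norm \<beta> (symbol_mult (J_symbol (- 2)) (hat u1))))"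
    proof (intro exI[of _ "2 * K"] conjI allI impI)
      fix u0 u1 :: "(real ^ 'n) distribution" and u ut and t :: real
      assume sol: "sobolev_solution b g u0 u1 u ut" and t: "t \<ge> 0"
      note [measurable] = meas[OF sol]
      have "L2_norm_dist (fourier_multiplier ?D (u t)) \<le> L2_norm (symbol_mult ?D (hat (u t)))"
        using multiplier[OF sol t] by simp
      also have "\<dots> \<le> ennreal (2 * K) * (L2_norm (symbol_mult ?D (hat u0)) + L2_norm (symbol_mult ?D (symbol_mult (J_symbol (- 2)) (hat u1))))"
      proof (rule L2_norm_le_sum)
        show "AE \<xi> in lborel. norm (symbol_mult ?D (hat (u t)) \<xi>)
            \<le> K * (norm (symbol_mult ?D (hat u0) \<xi>)
            + norm (symbol_mult ?D (symbol_mult (J_symbol (- 2)) (hat u1)) \<xi>))"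
          using mode[OF sol t]
        proof eventually_elim
          case (elim \<xi>)
          from mult_left_mono[OF elim[THEN conjunct1] D_symbol_nonneg[of \<beta> \<xi>]]
          show ?case by (simp add: norm_D norm_J algebra_simps)
        qed
      qed (use K in \<open>auto intro: less_imp_le\<close>)
      finally show "L2_norm_dist (fourier_multiplier ?D (u t)) \<le>
        ennreal (2 * K) * (hdot_norm \<beta> (hat u0) + hdot_norm \<beta> (symbol_mult (J_symbol (- 2)) (hat u1)))"
        by (simp only: hdot_norm_def)
    qed (use K in simp)
    show "\<exists>C>0. \<forall>(u0 :: (real ^ 'n) distribution) u1 u ut. sobolev_solution b g u0 u1 u ut \<longrightarrow>
        (\<forall>t\<ge>0. L2_norm_dist (fourier_multiplier (D_symbol \<beta>) (ut t)) \<le>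
          ennreal C *
            (ennreal (g t) * (hdot_norm (\<beta> + 2) (hat u0)
                              + hdot_norm (\<beta> + 2) (symbol_mult (J_symbol (- 2)) (hat u1)))
             + ennreal (b t) * (hdot_norm \<beta> (hat u0)
                                + hdot_norm \<beta> (symbol_mult (J_symbol (- 2)) (hat u1)))))"
      if b'_nonneg: "\<forall>t\<ge>0. b' t \<ge> 0"
    proof -
      have b_mono: "b 0 \<le> b t" if "t \<ge> 0" for t
        by (rule half_line_mono[OF B1_deriv]) (use that b'_nonneg in auto)
      define c where "c = L * K + 1 / g 0 + 1 / b 0"
      have c: "c > 0" "L * K \<le> c" "1 / g 0 \<le> c" "1 / b 0 \<le> c"
        using K L_nonneg A1[of 0] b_pos[of 0] unfolding c_def by (auto intro!: add_nonneg_pos add_nonneg_nonneg)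
      show ?thesis
      proof (intro exI[of _ "2 * c * 2"] conjI allI impI)
        fix u0 u1 :: "(real ^ 'n) distribution" and u ut and t :: real
        assume sol: "sobolev_solution b g u0 u1 u ut" and t: "t \<ge> 0"
        note [measurable] = meas[OF sol]
        have gt: "g t > 0" and bt: "b t > 0" using A1[OF t] b_pos[OF t] by auto
        let ?J = "symbol_mult (J_symbol (- 2)) (hat u1)"
        \<comment> \<open>The sum of the two moduli, so that each of the two brackets of the bound is the norm of one
          function.\<close>
        define S where "S = (\<lambda>a (\<xi>::real^'n). complex_of_real (norm (symbol_mult (D_symbol a) (hat u0) \<xi>) + norm (symbol_mult (D_symbol a) ?J \<xi>)))"
        have norm_S: "norm (S a \<xi>) = D_symbol a \<xi> * (norm (hat u0 \<xi>) + X u1 \<xi>)" for a \<xi>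
          unfolding S_def norm_of_real using D_symbol_nonneg[of a \<xi>] X(1)[of u1 \<xi>]
          by (simp add: norm_D norm_J distrib_left)
        have [measurable]: "S a \<in> borel_measurable borel" for a
          unfolding S_def by measurable
        have scaled: "L2_norm (\<lambda>\<xi>. of_real k * S a \<xi>)
            \<le> ennreal 2 * (ennreal k * (hdot_norm a (hat u0) + hdot_norm a ?J))" if "k > 0"
          for k a
        proof -
          have "L2_norm (\<lambda>\<xi>. of_real k * S a \<xi>)
              \<le> ennreal (2 * k) * (L2_norm (symbol_mult (D_symbol a) (hat u0)) + L2_norm (symbol_mult (D_symbol a) ?J))"
            by (rule L2_norm_le_sum) (use that in \<open>auto simp: norm_mult norm_S norm_D norm_J distrib_left\<close>)
          then show ?thesis using that by (simp add: hdot_norm_def ennreal_mult mult.assoc)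
        qed
        have "L2_norm_dist (fourier_multiplier ?D (ut t)) \<le> L2_norm (symbol_mult ?D (hat (ut t)))"
          using multiplier[OF sol t] by simp
        also have "\<dots> \<le> ennreal (2 * c) * (L2_norm (\<lambda>\<xi>. of_real (g t) * S (\<beta> + 2) \<xi>) + L2_norm (\<lambda>\<xi>. of_real (b t) * S \<beta> \<xi>))"
        proof (rule L2_norm_le_sum)
          show "AE \<xi> in lborel. norm (symbol_mult ?D (hat (ut t)) \<xi>)
              \<le> c * (norm (of_real (g t) * S (\<beta> + 2) \<xi>) + norm (of_real (b t) * S \<beta> \<xi>))"
            using mode[OF sol t]
          proof eventually_elim
            case (elim \<xi>)
            define p q r where "p = norm (hat u0 \<xi>)" "q = X u1 \<xi>" "r = (norm \<xi>)\<^sup>2"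
            have nonneg: "p \<ge> 0" "q \<ge> 0" "r \<ge> 0" using X(1) by (auto simp: p_q_r_def)
            have "1 \<le> 1 / b 0 * b t" "1 \<le> 1 / g 0 * g t"
              using b_mono[OF t] g_mono[OF t] b_pos[of 0] A1[of 0] by (auto simp: field_simps)
            then have "1 * q + 1 * (r * q) \<le> 1 / b 0 * b t * q + 1 / g 0 * g t * (r * q)"
              using nonneg by (intro add_mono mult_right_mono) auto
            also have "\<dots> \<le> 1 / b 0 * (b t * (p + q)) + 1 / g 0 * (g t * (r * p + r * q))"
              using nonneg gt bt b_pos[of 0] A1[of 0] by (simp add: algebra_simps)
            finally have u1_le: "norm (hat u1 \<xi>)
                \<le> 1 / b 0 * (b t * (p + q)) + 1 / g 0 * (g t * (r * p + r * q))"
              using X(2)[of u1 \<xi>] by (simp add: p_q_r_def)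
            have pos: "0 \<le> g t * (r * p + r * q)" "0 \<le> b t * (p + q)" using nonneg gt bt by simp_all
            have "norm (hat (ut t) \<xi>)
                \<le> (L * K + 1 / g 0) * (g t * (r * p + r * q)) + 1 / b 0 * (b t * (p + q))"
              using elim u1_le by (simp add: p_q_r_def algebra_simps)
            also have "\<dots> \<le> c * (g t * (r * p + r * q)) + c * (b t * (p + q))"
              using pos c b_pos[of 0] by (intro add_mono mult_right_mono) (auto simp: c_def)
            finally have "norm (hat (ut t) \<xi>) \<le> c * (g t * (r * (p + q)) + b t * (p + q))"
              by (simp add: algebra_simps)
            from mult_left_mono[OF this D_symbol_nonneg[of \<beta> \<xi>]]
            show ?case
              using gt bt by (simp add: norm_D norm_mult norm_S D_symbol_add_2 p_q_r_def mult_ac distrib_left)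
          qed
        qed (use c in auto)
        also have "\<dots> \<le> ennreal (2 * c) * (ennreal 2 * (ennreal (g t) * (hdot_norm (\<beta> + 2) (hat u0) + hdot_norm (\<beta> + 2) ?J))
            + ennreal 2 * (ennreal (b t) * (hdot_norm \<beta> (hat u0) + hdot_norm \<beta> ?J)))"
          by (intro mult_left_mono add_mono scaled gt bt) simp
        also have "\<dots> = ennreal (2 * c * 2) * (ennreal (g t) * (hdot_norm (\<beta> + 2) (hat u0) + hdot_norm (\<beta> + 2) ?J)
            + ennreal (b t) * (hdot_norm \<beta> (hat u0) + hdot_norm \<beta> ?J))"
        proof -
          have split: "ennreal (2 * c * 2) = ennreal (2 * c) * ennreal 2"
            by (rule ennreal_mult) (use c in auto)
          show ?thesis unfolding split distrib_left[symmetric] by (simp only: mult.assoc)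
        qed
        finally show "L2_norm_dist (fourier_multiplier ?D (ut t)) \<le> ennreal (2 * c * 2) *
            (ennreal (g t) * (hdot_norm (\<beta> + 2) (hat u0) + hdot_norm (\<beta> + 2) ?J)
            + ennreal (b t) * (hdot_norm \<beta> (hat u0) + hdot_norm \<beta> ?J))" .
      qed (use c in simp)
    qed
    show "\<exists>C>0. \<forall>(u0 :: (real ^ 'n) distribution) u1 u ut. sobolev_solution b g u0 u1 u ut \<longrightarrow>
        (\<forall>t\<ge>0. L2_norm_dist (fourier_multiplier (D_symbol \<beta>) (ut t)) \<le>
          ennreal C *
            (ennreal (g t) * (hdot_norm (\<beta> + 2) (hat u0) + hdot_norm \<beta> (hat u1))
             + ennreal (b t) * (hdot_norm \<beta> (hat u0)
                                + hdot_norm \<beta> (symbol_mult (D_symbol (- 2)) (hat u1)))))"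
    proof -
      define c where "c = L * K + 1 / g 0"
      have c: "c > 0" using K L_nonneg A1[of 0] by (auto simp: c_def intro: add_nonneg_pos)
      show ?thesis
      proof (intro exI[of _ "2 * c"] conjI allI impI)
        fix u0 u1 :: "(real ^ 'n) distribution" and u ut and t :: real
        assume sol: "sobolev_solution b g u0 u1 u ut" and t: "t \<ge> 0"
        note [measurable] = meas[OF sol]
        have gt: "g t > 0" using A1[OF t] by simp
        have "L2_norm_dist (fourier_multiplier ?D (ut t)) \<le> L2_norm (symbol_mult ?D (hat (ut t)))"
          using multiplier[OF sol t] by simp
        also have "\<dots> \<le> ennreal (2 * (c * g t)) * (L2_norm (symbol_mult (D_symbol (\<beta> + 2)) (hat u0)) + L2_norm (symbol_mult ?D (hat u1)))"
        proof (rule L2_norm_le_sum)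
          show "AE \<xi> in lborel. norm (symbol_mult ?D (hat (ut t)) \<xi>)
              \<le> c * g t * (norm (symbol_mult (D_symbol (\<beta> + 2)) (hat u0) \<xi>) + norm (symbol_mult ?D (hat u1) \<xi>))"
            using mode[OF sol t]
          proof eventually_elim
            case (elim \<xi>)
            define p q r where "p = norm (hat u0 \<xi>)" "q = norm (hat u1 \<xi>)" "r = (norm \<xi>)\<^sup>2"
            have nonneg: "p \<ge> 0" "q \<ge> 0" "r \<ge> 0" by (auto simp: p_q_r_def)
            have "(norm \<xi>)\<^sup>2 * X u1 \<xi> \<le> q" using X(1)[of u1 \<xi>] X(2)[of u1 \<xi>]
              by (simp add: p_q_r_def)
            then have "L * K * (g t * (r * p + (norm \<xi>)\<^sup>2 * X u1 \<xi>)) \<le> L * K * (g t * (r * p + q))"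
              using L_nonneg K gt by (intro mult_left_mono add_left_mono) auto
            moreover have "q \<le> 1 / g 0 * (g t * (r * p + q))"
            proof -
              have "1 \<le> g t / g 0" using g_mono[OF t] A1[of 0] by simp
              then have "1 * (r * p + q) \<le> g t / g 0 * (r * p + q)"
                using nonneg by (intro mult_right_mono) auto
              moreover have "q \<le> 1 * (r * p + q)" using nonneg by simp
              ultimately show ?thesis by simp
            qed
            ultimately have "norm (hat (ut t) \<xi>) \<le> c * g t * (r * p + q)"
              using elim by (simp add: c_def p_q_r_def algebra_simps)
            from mult_left_mono[OF this D_symbol_nonneg[of \<beta> \<xi>]]
            show ?case by (simp add: norm_D D_symbol_add_2 p_q_r_def algebra_simps)
          qed
        qed (use c gt in auto)
        also have "\<dots> = ennreal (2 * c) * (ennreal (g t) * (hdot_norm (\<beta> + 2) (hat u0) + hdot_norm \<beta> (hat u1)))"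
          using c gt by (simp add: hdot_norm_def ennreal_mult mult.assoc)
        also have "\<dots> \<le> ennreal (2 * c) * (ennreal (g t) * (hdot_norm (\<beta> + 2) (hat u0) + hdot_norm \<beta> (hat u1))
             + ennreal (b t) * (hdot_norm \<beta> (hat u0) + hdot_norm \<beta> (symbol_mult (D_symbol (- 2)) (hat u1))))"
          by (intro mult_left_mono) auto
        finally show "L2_norm_dist (fourier_multiplier ?D (ut t)) \<le> ennreal (2 * c) *
            (ennreal (g t) * (hdot_norm (\<beta> + 2) (hat u0) + hdot_norm \<beta> (hat u1))
             + ennreal (b t) * (hdot_norm \<beta> (hat u0) + hdot_norm \<beta> (symbol_mult (D_symbol (- 2)) (hat u1))))" .
      qed (use c in simp)
    qed
  qed
qed

end
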